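(* Let $d\ge 2$ be an integer and let $\{X_{\mathbf n};\ \mathbf n\in\mathbb N^d\}$ be a negatively associated field of identically distributed random variables satisfying $$\mathbb E X_{\mathbf 1}=0\quad\text{and}\quad \mathbb E\Big[X_{\mathbf 1}^2\,\log^{d-1}(|X_{\mathbf 1}|)\big/\log\log(|X_{\mathbf 1}|)\Big]<\infty .$$ Then $$\limsup_{\mathbf n\to\infty}\frac{|S_{\mathbf n}|}{(2d|\mathbf n|\log\log|\mathbf n|)^{1/2}}\le(\mathbb E X_{\mathbf 1}^2)^{1/2}\quad\text{a.s.}$$
   Context: A finite family $\{X_i;1\le i\le n\}$ of random variables is negatively associated if for every pair of disjoint subsets $A,B\subset\{1,\dots,n\}$, $\operatorname{Cov}(f(X_i;i\in A),g(X_j;j\in B))\le 0$ whenever $f,g$ are coordinatewise non-decreasing and the covariance exists; an infinite family is negatively associated if every finite subfamily is. For $\mathbf n=(n_1,\dots,n_d)\in\mathbb N^d$, $|\mathbf n|=n_1\cdots n_d$; $\mathbf k\le\mathbf n$ means $k_i\le n_i$ for all $i$; $\mathbf 1=(1,\dots,1)$; $S_{\mathbf n}=\sum_{\mathbf k\le\mathbf n}X_{\mathbf k}$; $\mathbf n\to\infty$ means $n_1\to\infty,\dots,n_d\to\infty$. Throughout, $\log x=\ln(x\vee e)$. *)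

theory Defs
  imports "HOL-Probability.Probability"
begin

text \<open>The paper's logarithm convention: log x = ln (max x e).\<close>
definition Log :: "real \<Rightarrow> real" where
  "Log x = ln (max x (exp 1))"

definition coord_mono :: "'i set \<Rightarrow> (('i \<Rightarrow> real) \<Rightarrow> real) \<Rightarrow> bool" where
  "coord_mono A f \<longleftrightarrow>
     (\<forall>x y. x \<in> extensional A \<longrightarrow> y \<in> extensional A \<longrightarrow>
        (\<forall>i\<in>A. x i \<le> y i) \<longrightarrow> f x \<le> f y)"

definition neg_assoc :: "'a measure \<Rightarrow> 'i set \<Rightarrow> ('i \<Rightarrow> 'a \<Rightarrow> real) \<Rightarrow> bool" where
  "neg_assoc M I X \<longleftrightarrow>
     (\<forall>A B f g. finite A \<and> finite B \<and> A \<subseteq> I \<and> B \<subseteq> I \<and> A \<inter> B = {} \<and>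
        coord_mono A f \<and> coord_mono B g \<and>
        integrable M (\<lambda>\<omega>. f (restrict (\<lambda>i. X i \<omega>) A)) \<and>
        integrable M (\<lambda>\<omega>. g (restrict (\<lambda>i. X i \<omega>) B)) \<and>
        integrable M (\<lambda>\<omega>. f (restrict (\<lambda>i. X i \<omega>) A) * g (restrict (\<lambda>i. X i \<omega>) B))
      \<longrightarrow> (\<integral>\<omega>. f (restrict (\<lambda>i. X i \<omega>) A) * g (restrict (\<lambda>i. X i \<omega>) B) \<partial>M)
          - (\<integral>\<omega>. f (restrict (\<lambda>i. X i \<omega>) A) \<partial>M) * (\<integral>\<omega>. g (restrict (\<lambda>i. X i \<omega>) B) \<partial>M)
          \<le> 0)"

definition multi_at_top :: "('d \<Rightarrow> nat) filter" where
  "multi_at_top = (INF i. filtercomap (\<lambda>n. n i) at_top)"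

definition pos_idx :: "('d \<Rightarrow> nat) set" where
  "pos_idx = {n. \<forall>i. 1 \<le> n i}"

definition idx_size :: "('d::finite \<Rightarrow> nat) \<Rightarrow> nat" where
  "idx_size n = (\<Prod>i\<in>UNIV. n i)"

definition partial_sum :: "(('d \<Rightarrow> nat) \<Rightarrow> 'a \<Rightarrow> real) \<Rightarrow> ('d \<Rightarrow> nat) \<Rightarrow> 'a \<Rightarrow> real" where
  "partial_sum X n \<omega> = (\<Sum>k\<in>{k. \<forall>i. 1 \<le> k i \<and> k i \<le> n i}. X k \<omega>)"

end

theory Submission
  imports Defs "HOL-Real_Asymp.Real_Asymp"
begin

text \<open>
  Applied to \<open>X\<close> and \<open>- X\<close>, a one-sided bound suffices.  Cut the index set into dyadic blocks
  \<open>2 ^ m i \<le> n i < 2 ^ (m i + 1)\<close> and put \<open>s = (\<Sum>i. m i)\<close>, so that \<open>|n|\<close> has order \<open>2 ^ s\<close>; there are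
  at most \<open>(s + 1) ^ (d - 1)\<close> blocks with a given \<open>s\<close>.  Write \<open>L = log log (2 ^ s)\<close>,
  \<open>a = sqrt (2 ^ s L) / s\<close> and split \<open>X = min X a + max (X - a) 0\<close>.

  Negative association bounds the exponential moments of \<open>\<Sum>k. min (X k) a\<close> over every finite index set
  by those of independent copies, and \<open>min X a\<close> has nonpositive mean.  On finitely many grid points per
  block the resulting Bernstein bound is of order \<open>exp (- (1 + \<eta>) d L)\<close>, summable over the blocks.  No
  maximal inequality is needed to pass to all \<open>n\<close>: chain in two steps, through a grid with \<open>s\<close> points
  per coordinate, since rectangles with nested corners differ by a finite index set of small size.

  The excess \<open>max (X - a) 0\<close> is nonnegative, so its sums are monotone in \<open>n\<close> and one rectangle per block
  suffices.  Cut off at \<open>b = c sqrt (2 ^ s L)\<close>, it is handled by the same exponential bound, as the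
  moment condition makes \<open>E [X^2; X > a]\<close> of order \<open>o (L / s)\<close>; and \<open>X k > b\<close> happens
  for only finitely many \<open>k\<close>, again by the moment condition.
\<close>

section \<open>The iterated logarithm along powers of two\<close>

text \<open>Taylor expansion with Lagrange remainder: for \<open>y \<ge> 0\<close> the intermediate
  point is at most \<open>c\<close>; for \<open>y < 0\<close> the cubic remainder is negative and
  \<open>exp c \<ge> 1\<close>. Since \<open>y\<close> is bounded only from above, the estimate fits
  variables truncated on one side.\<close>

lemma exp_le_quadratic:
  fixes y c :: real
  assumes "y \<le> c" "0 \<le> c"
  shows "exp y \<le> 1 + y + y\<^sup>2 / 2 * exp c"
proof (cases "y \<ge> 0")
  case True
  obtain t where t: "\<bar>t\<bar> \<le> \<bar>y\<bar>" "exp y = (\<Sum>m<2. y ^ m / fact m) + exp t / fact 2 * y ^ 2"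
    using Maclaurin_exp_le by blast
  have "exp t \<le> exp c" using t(1) True assms by simp
  then have "y\<^sup>2 / 2 * exp t \<le> y\<^sup>2 / 2 * exp c" by (intro mult_left_mono) auto
  then show ?thesis using t(2) by (simp add: numeral_2_eq_2 field_simps)
next
  case False
  obtain t where t: "exp y = (\<Sum>m<3. y ^ m / fact m) + exp t / fact 3 * y ^ 3"
    using Maclaurin_exp_le by blast
  have "exp t / fact 3 * y ^ 3 \<le> 0"
    using False by (intro mult_nonneg_nonpos) (auto simp: power3_eq_cube mult_nonneg_nonpos mult_nonneg_nonneg split_mult_pos_le mult_le_0_iff)
  moreover have "y\<^sup>2 / 2 * 1 \<le> y\<^sup>2 / 2 * exp c" using assms by (intro mult_left_mono) auto
  ultimately show ?thesis using t by (simp add: eval_nat_numeral field_simps)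
qed

lemma Log_ge_1: "1 \<le> Log x"
proof -
  have "ln (exp 1) \<le> ln (max x (exp 1))"
    by (subst ln_le_cancel_iff) (simp_all add: less_max_iff_disj)
  then show ?thesis by (simp add: Log_def)
qed

lemma Log_mono: "x \<le> y \<Longrightarrow> Log x \<le> Log y"
  unfolding Log_def by (subst ln_le_cancel_iff) (simp_all add: less_max_iff_disj)

lemma Log_le_self: "1 \<le> y \<Longrightarrow> Log y \<le> y"
  unfolding Log_def by (auto simp: max_def intro: order_trans[OF ln_le_minus_one])

lemma Log_measurable [measurable]: "Log \<in> borel_measurable borel"
  unfolding Log_def by measurable

definition LL :: "nat \<Rightarrow> real" where
  "LL s = Log (Log (2 ^ s))"

lemma LL_ge_1: "1 \<le> LL s"
  by (simp add: LL_def Log_ge_1)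

lemma ln2_bounds: "9/16 \<le> ln (2::real)" "ln (2::real) < 1"
proof -
  \<comment> \<open>From \<open>(5/4)^3 < 2\<close> and
    \<open>ln (1 + x) \<ge> x - x\<^sup>2\<close> at \<open>x = 1/4\<close> comes
    \<open>3 * 3/16 = 9/16\<close>.\<close>
  have "ln ((5/4)^3) \<le> ln (2::real)" by (subst ln_le_cancel_iff) (auto simp: power3_eq_cube)
  then have "3 * ln (5/4::real) \<le> ln 2" by (simp add: ln_realpow)
  moreover have "1/4 - (1/4)\<^sup>2 \<le> ln (1 + 1/4::real)" by (rule ln_one_plus_pos_lower_bound) auto
  ultimately show "9/16 \<le> ln (2::real)" by (simp add: power2_eq_square)
  show "ln (2::real) < 1" by (rule ln_2_less_1)
qed

text \<open>From \<open>s = 8\<close> on, \<open>s * ln 2 \<ge> 9/2\<close> exceeds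
  \<open>exp 1\<close>, so the maximum is inactive in both logarithms.\<close>

lemma LL_eq: assumes "8 \<le> s" shows "LL s = ln (real s * ln 2)"
proof -
  have "real s * (9/16) \<le> real s * ln 2" using ln2_bounds by (intro mult_left_mono) auto
  moreover have "8 \<le> real s" using assms by simp
  ultimately have 1: "exp 1 \<le> real s * ln 2" using exp_le by argo
  have "exp 1 \<le> (2::real) ^ 8" using exp_le by simp
  also have "\<dots> \<le> 2 ^ s" using assms by (intro power_increasing) auto
  finally have "Log (2 ^ s) = real s * ln 2" by (simp add: Log_def max_def ln_realpow)
  then show ?thesis using 1 by (simp add: LL_def Log_def max_def)
qed

lemma LL_ge_ln_Suc: assumes "8 \<le> s" shows "ln (1 + real s) - ln 2 \<le> LL s"
proof -
  have "real s * (9/16) \<le> real s * ln 2" using ln2_bounds by (intro mult_left_mono) auto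
  moreover have "8 \<le> real s" using assms by simp
  ultimately have "(1 + real s) / 2 \<le> real s * ln 2" by argo
  then have "ln ((1 + real s) / 2) \<le> ln (real s * ln 2)" by simp
  then show ?thesis using assms by (simp add: LL_eq ln_div)
qed

text \<open>Turns exponential bounds in \<open>LL s\<close> into powers of \<open>s\<close>, for
  which summing over levels is a p-series.\<close>

lemma exp_LL_le: assumes "8 \<le> s" "0 \<le> \<theta>"
  shows "exp (- \<theta> * LL s) \<le> 2 powr \<theta> * (1 + real s) powr (- \<theta>)"
proof -
  have "- \<theta> * LL s \<le> \<theta> * ln 2 + (- \<theta>) * ln (1 + real s)"
    using mult_left_mono[OF LL_ge_ln_Suc[OF assms(1)] assms(2)] by (simp add: algebra_simps)
  then have "exp (- \<theta> * LL s) \<le> exp (\<theta> * ln 2 + (- \<theta>) * ln (1 + real s))" by simp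
  also have "\<dots> = 2 powr \<theta> * (1 + real s) powr (- \<theta>)"
    by (simp only: exp_add) (simp add: powr_def)
  finally show ?thesis .
qed

lemma le_exp_LL: assumes "8 \<le> s" shows "real s \<le> 2 * exp (LL s)" "exp (LL s) \<le> real s"
proof -
  have "exp (LL s) = real s * ln 2" using assms by (simp add: LL_eq)
  moreover have "real s * (9/16) \<le> real s * ln 2" "real s * ln 2 \<le> real s * 1"
    using ln2_bounds by (intro mult_left_mono; simp)+
  ultimately show "real s \<le> 2 * exp (LL s)" "exp (LL s) \<le> real s" by linarith+
qed

lemma eventually_LL_eq: "eventually (\<lambda>s. LL s = ln (real s * ln 2)) sequentially"
  using eventually_ge_at_top[of 8] by eventually_elim (rule LL_eq)

lemma LL_at_top: "filterlim LL at_top sequentially"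
proof -
  have "filterlim (\<lambda>s. ln (real s * ln 2)) at_top sequentially" by real_asymp
  then show ?thesis using eventually_LL_eq by (subst filterlim_cong[OF refl refl])
qed

lemma LL_over_s: "(\<lambda>s. LL s / real s) \<longlonglongrightarrow> 0"
proof -
  have "(\<lambda>s. ln (real s * ln 2) / real s) \<longlonglongrightarrow> 0" by real_asymp
  moreover have "eventually (\<lambda>s. LL s / real s = ln (real s * ln 2) / real s) sequentially"
    using eventually_LL_eq by eventually_elim simp
  ultimately show ?thesis by (subst tendsto_cong)
qed

text \<open>The largest truncation level (up to constants) at which the Bernstein bound still absorbs
  a union bound over the \<open>2 ^ s\<close> indices of a block; for \<open>d = 2\<close> it is at the same time just large
  enough for the means of the cut-off parts to be negligible.\<close>
definition trunc :: "nat \<Rightarrow> real" where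
  "trunc s = sqrt (2 ^ s * LL s) / real s"

lemma trunc_pos: "0 < s \<Longrightarrow> 0 < trunc s"
  using LL_ge_1[of s] by (simp add: trunc_def)

lemma eventually_trunc_ge: "eventually (\<lambda>s. 2 powr (real s / 4) \<le> trunc s) sequentially"
proof -
  have "eventually (\<lambda>s. 2 powr (real s / 4) \<le> 2 powr (real s / 2) / real s) sequentially"
    by real_asymp
  then show ?thesis
  proof eventually_elim
    case (elim s)
    have "2 powr (real s / 2) = sqrt (2 ^ s * 1)"
      by (simp add: powr_half_sqrt[symmetric] powr_powr powr_realpow[symmetric])
    also have "\<dots> \<le> sqrt (2 ^ s * LL s)" using LL_ge_1 by (intro real_sqrt_le_mono mult_left_mono) auto
    finally have "2 powr (real s / 2) / real s \<le> trunc s"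
      unfolding trunc_def by (rule divide_right_mono) simp
    then show ?case using elim by simp
  qed
qed

lemma eventually_sqrt_ge: 
  assumes "c > 0"
  shows "eventually (\<lambda>s. 2 powr (real s / 4) \<le> c * sqrt (2 ^ s * LL s)) sequentially"
proof -
  have "eventually (\<lambda>s. 2 powr (real s / 4) \<le> c * 2 powr (real s / 2)) sequentially"
    using assms by real_asymp
  then show ?thesis
  proof eventually_elim
    case (elim s)
    have "2 powr (real s / 2) = sqrt (2 ^ s * 1)"
      by (simp add: powr_half_sqrt[symmetric] powr_powr powr_realpow[symmetric])
    also have "\<dots> \<le> sqrt (2 ^ s * LL s)" using LL_ge_1 by (intro real_sqrt_le_mono mult_left_mono) auto
    finally have "c * 2 powr (real s / 2) \<le> c * sqrt (2 ^ s * LL s)"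
      using assms by (intro mult_left_mono) auto
    then show ?case using elim by simp
  qed
qed

text \<open>Beyond \<open>2 powr (s / 4)\<close> the logarithm of \<open>x\<close> is at least of
  order \<open>s\<close>, and \<open>y ^ D / ln y\<close> increases for \<open>y \<ge> exp 1\<close>
  because \<open>D \<ge> 1\<close>. Every truncation level in use eventually exceeds
  \<open>2 powr (s / 4)\<close>, so this converts the moment condition into rates in
  \<open>s\<close>.\<close>

lemma moment_weight_ge:
  assumes "0 < D"
  obtains \<kappa> where "\<kappa> > 0"
    "eventually (\<lambda>s. \<forall>x\<ge>2 powr (real s / 4).
       \<kappa> * (1 + real s) ^ D / LL s \<le> Log x ^ D / Log (Log x)) sequentially"
proof
  \<comment> \<open>\<open>ln x \<ge> s / 4 * ln 2\<close>, and \<open>1 + s \<le> 2 * s\<close>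
    costs another factor two.\<close>
  define k where "k = ln (2::real) / 8"
  have k: "k > 0" by (simp add: k_def)
  show "k ^ D > 0" using k by simp
  have ev: "eventually (\<lambda>s. exp 1 \<le> k * (1 + real s)) sequentially"
    using k by real_asymp
  show "eventually (\<lambda>s. \<forall>x\<ge>2 powr (real s / 4).
       k ^ D * (1 + real s) ^ D / LL s \<le> Log x ^ D / Log (Log x)) sequentially"
    using ev eventually_ge_at_top[of 8]
  proof eventually_elim
    case (elim s)
    show ?case
    proof (intro allI impI)
      fix x :: real assume x: "2 powr (real s / 4) \<le> x"
      define y0 where "y0 = k * (1 + real s)"
      define y where "y = Log x"
      have y0: "exp 1 \<le> y0" using elim by (simp add: y0_def)
      have y0_pos: "0 < y0" using y0 exp_gt_zero[of "1::real"] by linarith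
      have x0: "0 < x" using x by (rule less_le_trans[rotated]) simp
      have "real s / 4 * ln 2 = ln (2 powr (real s / 4))" by simp
      also have "\<dots> \<le> ln x" using x x0 by (subst ln_le_cancel_iff) auto
      also have "\<dots> \<le> y" unfolding y_def Log_def using x0 by (subst ln_le_cancel_iff) auto
      finally have y1: "real s / 4 * ln 2 \<le> y" .
      have "y0 = (1 + real s) / 8 * ln 2" by (simp add: y0_def k_def)
      also have q: "\<dots> \<le> real s / 4 * ln 2" using elim by (intro mult_right_mono) auto
      finally have y: "y0 \<le> y" using y1 by simp
      have "real s / 4 * ln 2 \<le> real s * ln 2" by (intro mult_right_mono) auto
      then have "y0 \<le> real s * ln 2" using q by (simp add: y0_def k_def)
      then have LLs: "ln y0 \<le> LL s" using elim y0_pos by (simp add: LL_eq)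
      have Logy: "Log y = ln y" using y0 y by (simp add: Log_def max_absorb1)
      have lnpos: "0 < ln y0" "0 < ln y" using y0 y
        by (metis exp_ge_zero less_le_trans ln_exp ln_gt_zero not_le one_less_exp_iff zero_less_one)
           (metis y0 y exp_ge_zero less_le_trans ln_exp ln_gt_zero not_le one_less_exp_iff zero_less_one)
      \<comment> \<open>Only the single factor \<open>y / ln y\<close> needs an argument; the
        remaining \<open>D - 1\<close> factors \<open>y\<close> are plainly monotone.\<close>
      have "ln y / y \<le> ln y0 / y0" by (rule ln_x_over_x_mono[OF y0 y])
      then have "y0 / ln y0 \<le> y / ln y"
        using lnpos y0_pos y by (simp add: field_simps)
      moreover have "y0 / LL s \<le> y0 / ln y0"
        using LLs lnpos y0_pos LL_ge_1[of s] by (intro divide_left_mono mult_pos_pos) auto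
      ultimately have m: "y0 / LL s \<le> y / ln y" by simp
      have "y0 ^ D / LL s = y0 ^ (D - 1) * (y0 / LL s)" using assms by (cases D) auto
      also have "\<dots> \<le> y ^ (D - 1) * (y / ln y)"
        using m y y0_pos lnpos LL_ge_1[of s] by (intro mult_mono power_mono divide_nonneg_nonneg) auto
      also have "\<dots> = y ^ D / Log y" unfolding Logy using assms by (cases D) auto
      finally show "k ^ D * (1 + real s) ^ D / LL s \<le> Log x ^ D / Log (Log x)"
        by (simp add: y0_def power_mult_distrib y_def)
    qed
  qed
qed

section \<open>Exponential bounds under negative association\<close>

lemma (in prob_space) prob_UN_le:
  assumes "finite I" "\<And>i. i \<in> I \<Longrightarrow> A i \<in> events" "\<And>i. i \<in> I \<Longrightarrow> prob (A i) \<le> x"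
  shows "prob (\<Union>i\<in>I. A i) \<le> real (card I) * x"
proof -
  have "prob (\<Union>i\<in>I. A i) \<le> (\<Sum>i\<in>I. prob (A i))"
    using assms by (intro finite_measure_subadditive_finite) auto
  also have "\<dots> \<le> real (card I) * x" using assms(3) by (rule sum_bounded_above)
  finally show ?thesis .
qed

locale na_family = prob_space M for M :: "'a measure" +
  fixes I :: "'i set" and X :: "'i \<Rightarrow> 'a \<Rightarrow> real" and i0 :: 'i
  assumes i0: "i0 \<in> I"
    and X_meas: "\<And>i. i \<in> I \<Longrightarrow> X i \<in> borel_measurable M"
    and X_na: "neg_assoc M I X"
    and X_ident: "\<And>i. i \<in> I \<Longrightarrow> distr M borel (X i) = distr M borel (X i0)"
begin

lemma expectation_ident:
  assumes "h \<in> borel_measurable borel" "i \<in> I"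
  shows "expectation (\<lambda>\<omega>. h (X i \<omega>)) = expectation (\<lambda>\<omega>. h (X i0 \<omega>) :: real)"
  using integral_distr[OF X_meas[OF assms(2)] assms(1)] integral_distr[OF X_meas[OF i0] assms(1)]
  by (simp add: X_ident[OF assms(2)])

text \<open>Induction on \<open>A\<close>: one factor and the product of the others depend on
  disjoint index sets and, \<open>h\<close> being nonnegative and monotone, are both coordinatewise
  nondecreasing, so their covariance is at most zero. The bound \<open>B\<close> secures
  integrability.\<close>

lemma expectation_prod_le:
  fixes h :: "real \<Rightarrow> real"
  assumes h: "mono h" "\<And>x. 0 \<le> h x" "\<And>x. h x \<le> B"
    and A: "finite A" "A \<subseteq> I"
  shows "expectation (\<lambda>\<omega>. \<Prod>i\<in>A. h (X i \<omega>)) \<le> expectation (\<lambda>\<omega>. h (X i0 \<omega>)) ^ card A"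
  using A
proof (induction A rule: finite_induct)
  case empty
  then show ?case by (simp add: prob_space)
next
  case (insert j A)
  have hm [measurable]: "h \<in> borel_measurable borel" by (rule borel_measurable_mono[OF h(1)])
  have Xm: "\<And>i. i \<in> insert j A \<Longrightarrow> X i \<in> borel_measurable M" using insert.prems X_meas by blast
  have m1: "(\<lambda>\<omega>. h (X i \<omega>)) \<in> borel_measurable M" if "i \<in> insert j A" for i
    using Xm[OF that] by measurable
  have m2: "(\<lambda>\<omega>. \<Prod>i\<in>C. h (X i \<omega>)) \<in> borel_measurable M" if "C \<subseteq> insert j A" for C
    using m1 that by (intro borel_measurable_prod) auto
  have int: "integrable M (\<lambda>\<omega>. \<Prod>i\<in>C. h (X i \<omega>))" if "C \<subseteq> insert j A" for C
  proof (rule integrable_const_bound[where B = "B ^ card C"])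
    show "AE \<omega> in M. norm (\<Prod>i\<in>C. h (X i \<omega>)) \<le> B ^ card C"
      using h prod_mono[of C "\<lambda>i. h (X i _)" "\<lambda>_. B"] by (auto simp: abs_prod)
  qed (rule m2[OF that])
  define f g where "f = (\<lambda>x :: 'i \<Rightarrow> real. h (x j))" and "g = (\<lambda>x :: 'i \<Rightarrow> real. \<Prod>i\<in>A. h (x i))"
  have f: "f (restrict (\<lambda>i. X i \<omega>) {j}) = h (X j \<omega>)" for \<omega> by (simp add: f_def)
  have g: "g (restrict (\<lambda>i. X i \<omega>) A) = (\<Prod>i\<in>A. h (X i \<omega>))" for \<omega> by (simp add: g_def)
  have fg: "f (restrict (\<lambda>i. X i \<omega>) {j}) * g (restrict (\<lambda>i. X i \<omega>) A)
      = (\<Prod>i\<in>insert j A. h (X i \<omega>))" for \<omega>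
    using insert by (simp add: f g)
  have "coord_mono {j} f" "coord_mono A g"
    using h unfolding coord_mono_def f_def g_def by (auto intro!: prod_mono dest: monoD)
  then have "expectation (\<lambda>\<omega>. \<Prod>i\<in>insert j A. h (X i \<omega>))
      \<le> expectation (\<lambda>\<omega>. h (X j \<omega>)) * expectation (\<lambda>\<omega>. \<Prod>i\<in>A. h (X i \<omega>))"
    using X_na[unfolded neg_assoc_def, rule_format, of "{j}" A f g] insert
      int[of "{j}"] int[of A] int[of "insert j A"]
    unfolding fg f g by auto
  also have "\<dots> \<le> expectation (\<lambda>\<omega>. h (X i0 \<omega>)) * expectation (\<lambda>\<omega>. h (X i0 \<omega>)) ^ card A"
    using insert h by (intro mult_mono) (auto intro!: Bochner_Integration.integral_nonneg prod_nonneg simp: expectation_ident[OF hm])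
  finally show ?case using insert by simp
qed

text \<open>Chernoff bound: Markov's inequality for \<open>exp (l * sum)\<close>, the product bound
  above, then the quadratic bound on the exponential and \<open>1 + x \<le> exp x\<close>. As
  \<open>\<phi>\<close> is bounded only from above, truncations such as \<open>min x a\<close>
  qualify. The parameter \<open>l\<close> stays free and is tuned in each application.\<close>

lemma prob_sum_ge:
  fixes \<phi> :: "real \<Rightarrow> real"
  assumes \<phi>: "mono \<phi>" "\<And>x. \<phi> x \<le> c" "0 \<le> c"
    and int: "integrable M (\<lambda>\<omega>. \<phi> (X i0 \<omega>))" "integrable M (\<lambda>\<omega>. (\<phi> (X i0 \<omega>))\<^sup>2)"
    and \<mu>: "expectation (\<lambda>\<omega>. \<phi> (X i0 \<omega>)) \<le> \<mu>" and v: "expectation (\<lambda>\<omega>. (\<phi> (X i0 \<omega>))\<^sup>2) \<le> v"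
    and A: "finite A" "A \<subseteq> I" and l: "0 \<le> l"
  shows "prob {\<omega> \<in> space M. t \<le> (\<Sum>i\<in>A. \<phi> (X i \<omega>))}
    \<le> exp (- l * t + real (card A) * (l * \<mu> + l\<^sup>2 / 2 * exp (l * c) * v))"
proof -
  define h where "h x = exp (l * \<phi> x)" for x
  have h: "mono h" "\<And>x. 0 \<le> h x" "\<And>x. h x \<le> exp (l * c)"
    using \<phi> l by (auto simp: h_def mono_def intro!: mult_left_mono)
  have hm [measurable]: "h \<in> borel_measurable borel" by (rule borel_measurable_mono[OF h(1)])
  have pm [measurable]: "\<phi> \<in> borel_measurable borel" by (rule borel_measurable_mono[OF \<phi>(1)])
  have Xm: "\<And>i. i \<in> A \<Longrightarrow> X i \<in> borel_measurable M" using A X_meas by blast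
  have X0 [measurable]: "X i0 \<in> borel_measurable M" by (rule X_meas[OF i0])
  have m2: "(\<lambda>\<omega>. \<Prod>i\<in>A. h (X i \<omega>)) \<in> borel_measurable M"
    using Xm by (intro borel_measurable_prod measurable_compose[OF _ hm])
  have int2: "integrable M (\<lambda>\<omega>. \<Prod>i\<in>A. h (X i \<omega>))"
  proof (rule integrable_const_bound[where B = "exp (l * c) ^ card A"])
    show "AE \<omega> in M. norm (\<Prod>i\<in>A. h (X i \<omega>)) \<le> exp (l * c) ^ card A"
      using h prod_mono[of A "\<lambda>i. h (X i _)" "\<lambda>_. exp (l * c)"] by (auto simp: abs_prod)
  qed (rule m2)
  have eq: "{\<omega> \<in> space M. t \<le> (\<Sum>i\<in>A. \<phi> (X i \<omega>))} \<subseteq> {\<omega> \<in> space M. exp (l * t) \<le> (\<Prod>i\<in>A. h (X i \<omega>))}"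
    using l A by (auto simp: h_def exp_sum[symmetric] sum_distrib_left[symmetric] mult_left_mono)
  have "prob {\<omega> \<in> space M. t \<le> (\<Sum>i\<in>A. \<phi> (X i \<omega>))} \<le> prob {\<omega> \<in> space M. exp (l * t) \<le> (\<Prod>i\<in>A. h (X i \<omega>))}"
    by (intro finite_measure_mono eq borel_measurable_le borel_measurable_const m2)
  also have "\<dots> \<le> expectation (\<lambda>\<omega>. \<Prod>i\<in>A. h (X i \<omega>)) / exp (l * t)"
    by (rule integral_Markov_inequality_measure[OF int2 sets.empty_sets]) (auto simp: h prod_nonneg)
  also have "\<dots> \<le> expectation (\<lambda>\<omega>. h (X i0 \<omega>)) ^ card A / exp (l * t)"
    using h A by (intro divide_right_mono expectation_prod_le) auto
  also have "\<dots> \<le> exp (l * \<mu> + l\<^sup>2 / 2 * exp (l * c) * v) ^ card A / exp (l * t)"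
  proof (intro divide_right_mono power_mono)
    have "expectation (\<lambda>\<omega>. h (X i0 \<omega>))
        \<le> expectation (\<lambda>\<omega>. 1 + l * \<phi> (X i0 \<omega>) + l\<^sup>2 / 2 * exp (l * c) * (\<phi> (X i0 \<omega>))\<^sup>2)"
    proof (rule integral_mono)
      show "integrable M (\<lambda>\<omega>. h (X i0 \<omega>))"
        by (rule integrable_const_bound[where B = "exp (l * c)"]) (auto simp: h)
      show "integrable M (\<lambda>\<omega>. 1 + l * \<phi> (X i0 \<omega>) + l\<^sup>2 / 2 * exp (l * c) * (\<phi> (X i0 \<omega>))\<^sup>2)"
        using int by (intro Bochner_Integration.integrable_add integrable_mult_right) auto
      fix \<omega>
      show "h (X i0 \<omega>) \<le> 1 + l * \<phi> (X i0 \<omega>) + l\<^sup>2 / 2 * exp (l * c) * (\<phi> (X i0 \<omega>))\<^sup>2"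
        using exp_le_quadratic[OF mult_left_mono[OF \<phi>(2) l], of "X i0 \<omega>"] \<phi>(3) l
        by (simp add: h_def power_mult_distrib mult_ac)
    qed
    also have "\<dots> = 1 + l * expectation (\<lambda>\<omega>. \<phi> (X i0 \<omega>))
        + l\<^sup>2 / 2 * exp (l * c) * expectation (\<lambda>\<omega>. (\<phi> (X i0 \<omega>))\<^sup>2)"
      using int by (simp add: prob_space)
    also have "\<dots> \<le> 1 + l * \<mu> + l\<^sup>2 / 2 * exp (l * c) * v"
      using \<mu> v l by (intro add_mono mult_left_mono) auto
    also have "\<dots> \<le> exp (l * \<mu> + l\<^sup>2 / 2 * exp (l * c) * v)"
      using exp_ge_add_one_self[of "l * \<mu> + l\<^sup>2 / 2 * exp (l * c) * v"] by (simp only: add.assoc)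
    finally show "expectation (\<lambda>\<omega>. h (X i0 \<omega>)) \<le> exp (l * \<mu> + l\<^sup>2 / 2 * exp (l * c) * v)" .
  qed (auto intro!: Bochner_Integration.integral_nonneg simp: h)
  also have "\<dots> = exp (- l * t + real (card A) * (l * \<mu> + l\<^sup>2 / 2 * exp (l * c) * v))"
    by (simp add: exp_of_nat_mult[symmetric] exp_diff[symmetric] mult_ac)
  finally show ?thesis .
qed

end

section \<open>Blocks and grids\<close>

definition Box :: "('d \<Rightarrow> nat) \<Rightarrow> ('d \<Rightarrow> nat) set" where
  "Box n = {k. \<forall>i. 1 \<le> k i \<and> k i \<le> n i}"

definition block :: "('d \<Rightarrow> nat) \<Rightarrow> ('d \<Rightarrow> nat) set" where
  "block m = {n. \<forall>i. 2 ^ m i \<le> n i \<and> n i < 2 ^ (m i + 1)}"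

lemma Box_eq_PiE: "Box n = (\<Pi>\<^sub>E i\<in>UNIV. {1..n i})"
  by (auto simp: Box_def PiE_def Pi_def)

lemma finite_Box [simp]: "finite (Box (n :: 'd::finite \<Rightarrow> nat))"
  unfolding Box_eq_PiE by (intro finite_PiE) auto

lemma card_Box: "card (Box (n :: 'd::finite \<Rightarrow> nat)) = idx_size n"
  unfolding Box_eq_PiE idx_size_def by (subst card_PiE) auto

lemma Box_subset_pos_idx: "Box n \<subseteq> pos_idx"
  by (auto simp: Box_def pos_idx_def)

lemma Box_mono: "(\<And>i. p i \<le> n i) \<Longrightarrow> Box p \<subseteq> Box n"
  unfolding Box_def using order_trans by blast

lemma block_eq_PiE: "block m = (\<Pi>\<^sub>E i\<in>UNIV. {2 ^ m i..<2 ^ (m i + 1)})"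
  by (auto simp: block_def PiE_def Pi_def)

lemma finite_block [simp]: "finite (block (m :: 'd::finite \<Rightarrow> nat))"
  unfolding block_eq_PiE by (intro finite_PiE) auto

lemma card_block: "card (block (m :: 'd::finite \<Rightarrow> nat)) = 2 ^ (\<Sum>i\<in>UNIV. m i)"
  unfolding block_eq_PiE by (subst card_PiE) (auto simp: power_sum)

lemma block_subset_pos_idx: "block m \<subseteq> pos_idx"
proof
  fix n assume n: "n \<in> block m"
  have "1 \<le> n i" for i
  proof -
    have "1 \<le> (2::nat) ^ m i" by simp
    also have "\<dots> \<le> n i" using n by (simp add: block_def)
    finally show ?thesis .
  qed
  then show "n \<in> pos_idx" by (simp add: pos_idx_def)
qed

lemma idx_size_mono: "(\<And>i. p i \<le> n i) \<Longrightarrow> idx_size p \<le> idx_size n"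
  unfolding idx_size_def by (intro prod_mono) auto

lemma idx_size_block_ge:
  fixes m :: "'d::finite \<Rightarrow> nat"
  assumes "n \<in> block m" shows "2 ^ (\<Sum>i\<in>UNIV. m i) \<le> idx_size n"
proof -
  have "(\<Prod>i\<in>UNIV. 2 ^ m i) \<le> idx_size n"
    unfolding idx_size_def using assms by (intro prod_mono) (auto simp: block_def)
  then show ?thesis by (simp add: power_sum)
qed

lemma idx_size_Suc_pow:
  fixes m :: "'d::finite \<Rightarrow> nat"
  shows "idx_size (\<lambda>i. 2 ^ (m i + 1)) = 2 ^ CARD('d) * 2 ^ (\<Sum>i\<in>UNIV. m i)"
  by (simp add: idx_size_def power_sum prod.distrib)

lemma idx_size_block_le:
  fixes m :: "'d::finite \<Rightarrow> nat"
  assumes "n \<in> block m" shows "idx_size n \<le> 2 ^ CARD('d) * 2 ^ (\<Sum>i\<in>UNIV. m i)"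
proof -
  have "idx_size n \<le> idx_size (\<lambda>i. 2 ^ (m i + 1))"
    using assms by (intro idx_size_mono) (auto simp: block_def less_imp_le)
  then show ?thesis by (simp only: idx_size_Suc_pow)
qed

lemma ex_block: assumes "k \<in> pos_idx" obtains m where "k \<in> block m"
proof -
  have "\<forall>i. \<exists>j. 2 ^ j \<le> k i \<and> k i < 2 ^ (j + 1)"
    by (intro allI ex_power_ivl1) (use assms in \<open>auto simp: pos_idx_def\<close>)
  then obtain m where "\<forall>i. 2 ^ m i \<le> k i \<and> k i < 2 ^ (m i + 1)" by metis
  then show ?thesis using that by (auto simp: block_def)
qed

lemma block_mono:
  assumes "k \<in> block l" "n \<in> block m" "\<And>i. k i \<le> n i"
  shows "l i \<le> m i"
proof -
  have "2 ^ l i \<le> k i" "n i < 2 ^ (m i + 1)" using assms by (auto simp: block_def)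
  then have "(2::nat) ^ l i < 2 ^ (m i + 1)" using assms(3)[of i] by linarith
  then show ?thesis by (subst (asm) power_strict_increasing_iff) auto
qed

text \<open>On a level the sum determines any one coordinate from the others, so deleting a
  coordinate is injective; this saves one power of \<open>s\<close>.\<close>

lemma card_level_le:
  "card {m :: 'd::finite \<Rightarrow> nat. (\<Sum>i\<in>UNIV. m i) = s} \<le> (s + 1) ^ (CARD('d) - 1)"
  "finite {m :: 'd::finite \<Rightarrow> nat. (\<Sum>i\<in>UNIV. m i) = s}"
proof -
  let ?L = "{m :: 'd \<Rightarrow> nat. (\<Sum>i\<in>UNIV. m i) = s}"
  obtain j :: 'd where True by simp
  define U where "U = - {j}"
  have le: "m i \<le> s" if "m \<in> ?L" for m i
    using that member_le_sum[of i UNIV m] by auto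
  have inj: "inj_on (\<lambda>m. restrict m U) ?L"
  proof (rule inj_onI)
    fix m n assume mn: "m \<in> ?L" "n \<in> ?L" "restrict m U = restrict n U"
    have eq: "m i = n i" if "i \<noteq> j" for i
      using fun_cong[OF mn(3), of i] that by (auto simp: U_def)
    have "(\<Sum>i\<in>UNIV. m i) = m j + (\<Sum>i\<in>U. m i)" "(\<Sum>i\<in>UNIV. n i) = n j + (\<Sum>i\<in>U. n i)"
      unfolding U_def by (subst sum.remove[of _ j]; simp add: Compl_eq_Diff_UNIV)+
    moreover have "(\<Sum>i\<in>U. m i) = (\<Sum>i\<in>U. n i)" using eq by (intro sum.cong) (auto simp: U_def)
    ultimately have "m j = n j" using mn by simp
    then show "m = n" using eq by (intro ext) metis
  qed
  have sub: "(\<lambda>m. restrict m U) ` ?L \<subseteq> (\<Pi>\<^sub>E i\<in>U. {0..s})" using le by auto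
  have fin: "finite (\<Pi>\<^sub>E i\<in>U. {0..s})" by (intro finite_PiE) auto
  show "finite ?L" using finite_imageD[OF finite_subset[OF sub fin] inj] .
  have "card ?L = card ((\<lambda>m. restrict m U) ` ?L)" by (rule card_image[OF inj, symmetric])
  also have "\<dots> \<le> card (\<Pi>\<^sub>E i\<in>U. {0..s})" by (rule card_mono[OF fin sub])
  also have "\<dots> = (s + 1) ^ card U" by (simp add: card_PiE)
  also have "card U = CARD('d) - 1" by (simp add: U_def Compl_eq_Diff_UNIV card_Diff_singleton)
  finally show "card ?L \<le> (s + 1) ^ (CARD('d) - 1)" .
qed

text \<open>The ceiling keeps the distance to the grid at most \<open>N / q\<close> even when \<open>N < q\<close>;
  then every integer of the interval is a grid point.\<close>
definition grid :: "nat \<Rightarrow> nat \<Rightarrow> nat set" where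
  "grid N q = (\<lambda>t. N + nat \<lceil>real t * real N / real q\<rceil>) ` {..<q}"

lemma grid_approx:
  assumes n: "N \<le> n" "n < 2 * N" and q: "0 < q"
  obtains p where "p \<in> grid N q" "N \<le> p" "p \<le> n" "real n - real p \<le> real N / real q"
proof -
  define y where "y = (real n - real N) * real q / real N"
  \<comment> \<open>The number of the last unrounded grid point not exceeding \<open>n\<close>; it
    is below \<open>q\<close> because \<open>n < 2 * N\<close>.\<close>
  define t where "t = nat \<lfloor>y\<rfloor>"
  have N: "0 < N" using n by simp
  have y0: "0 \<le> y" using n by (simp add: y_def)
  have ty: "real t \<le> y" "y < real t + 1" using y0 by (auto simp: t_def)
  have "real n - real N < real N" using n by linarith
  then have "y < real q" using N q by (simp add: y_def field_simps)
  then have tq: "t < q" using ty by linarith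
  define z where "z = real t * real N / real q"
  have z0: "0 \<le> z" by (simp add: z_def)
  have z1: "z \<le> real n - real N" using ty(1) N q by (simp add: z_def y_def field_simps)
  have z2: "real n - real N \<le> z + real N / real q"
    using ty(2) N q by (simp add: z_def y_def field_simps)
  define p where "p = N + nat \<lceil>z\<rceil>"
  \<comment> \<open>Rounding up cannot overshoot \<open>n\<close>, since \<open>n - N\<close> is
    itself an integer above \<open>z\<close>.\<close>
  have "\<lceil>z\<rceil> \<le> int n - int N" using z1 by (simp add: ceiling_le_iff)
  then have "p \<le> n" using z0 n by (simp add: p_def)
  moreover have "real N + z \<le> real p" using z0 by (simp add: p_def of_nat_nat) 
  then have "real n - real p \<le> real N / real q" using z2 by linarith
  moreover have "p \<in> grid N q" using tq by (auto simp: grid_def p_def z_def)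
  ultimately show ?thesis using that[of p] by (simp add: p_def)
qed

lemma finite_grid [simp]: "finite (grid N q)" by (simp add: grid_def)

lemma card_grid: "card (grid N q) \<le> q"
  unfolding grid_def using card_image_le[of "{..<q}"] by fastforce

text \<open>The intersection with the block matters: when \<open>q\<close> exceeds
  \<open>2 ^ m i\<close>, rounding up can produce the excluded endpoint
  \<open>2 ^ (m i + 1)\<close>.\<close>

definition Grid :: "('d \<Rightarrow> nat) \<Rightarrow> nat \<Rightarrow> ('d \<Rightarrow> nat) set" where
  "Grid m q = block m \<inter> (\<Pi>\<^sub>E i\<in>UNIV. grid (2 ^ m i) q)"

lemma finite_Grid [simp]: "finite (Grid (m :: 'd::finite \<Rightarrow> nat) q)"
  by (simp add: Grid_def)

lemma Grid_subset_block: "Grid m q \<subseteq> block m" by (simp add: Grid_def)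

lemma card_Grid: "card (Grid (m :: 'd::finite \<Rightarrow> nat) q) \<le> q ^ CARD('d)"
proof -
  have "card (Grid m q) \<le> card (\<Pi>\<^sub>E i\<in>UNIV. grid (2 ^ m i) q)"
    unfolding Grid_def by (intro card_mono finite_PiE) auto
  also have "\<dots> = (\<Prod>i\<in>UNIV. card (grid (2 ^ m i) q))" by (subst card_PiE) auto
  also have "\<dots> \<le> (\<Prod>i\<in>(UNIV :: 'd set). q)" by (intro prod_mono) (simp add: card_grid)
  finally show ?thesis by simp
qed

text \<open>Each coordinate loses at most the fraction \<open>1 / q\<close>, so by Bernoulli's
  inequality the volume loses at most the fraction \<open>d / q\<close>. Since \<open>p\<close> lies
  below \<open>n\<close>, the two rectangles are nested and the volume loss is the size of their
  difference.\<close>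

lemma Grid_approx:
  fixes m :: "'d::finite \<Rightarrow> nat"
  assumes n: "n \<in> block m" and q: "0 < q"
  obtains p where "p \<in> Grid m q" "\<And>i. p i \<le> n i"
    "real (card (Box n - Box p)) \<le> real CARD('d) / real q * (2 ^ CARD('d) * 2 ^ (\<Sum>i\<in>UNIV. m i))"
proof -
  have "\<exists>p. p \<in> grid (2 ^ m i) q \<and> 2 ^ m i \<le> p \<and> p \<le> n i \<and> real (n i) - real p \<le> real (2 ^ m i) / real q" for i
  proof -
    have "2 ^ m i \<le> n i" "n i < 2 * 2 ^ m i" using n by (auto simp: block_def)
    then show ?thesis using grid_approx[OF _ _ q] by metis
  qed
  then obtain p where p: "\<And>i. p i \<in> grid (2 ^ m i) q" "\<And>i. 2 ^ m i \<le> p i" "\<And>i. p i \<le> n i"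
    "\<And>i. real (n i) - real (p i) \<le> real (2 ^ m i) / real q" by metis
  have pb: "p \<in> block m"
    using p n le_less_trans[OF p(3)] unfolding block_def by simp
  have nge: "2 ^ m i \<le> n i" for i using n by (simp add: block_def)
  have npos: "0 < n i" for i using nge[of i] by (metis gr0I not_numeral_le_zero power_not_zero zero_neq_numeral le_zero_eq)
  have ratio: "1 - 1 / real q \<le> real (p i) / real (n i)" for i
  proof -
    have "real (2 ^ m i) / real q \<le> real (n i) / real q"
      using nge[of i] by (intro divide_right_mono of_nat_mono) auto
    then have "real (n i) - real (n i) / real q \<le> real (p i)" using p(4)[of i] by linarith
    then show ?thesis using npos[of i] q by (simp add: field_simps)
  qed
  have "1 - real CARD('d) * (1 / real q) \<le> (1 - 1 / real q) ^ CARD('d)"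
    using Bernoulli_inequality[of "- 1 / real q" "CARD('d)"] q by simp
  also have "\<dots> = (\<Prod>i\<in>(UNIV :: 'd set). 1 - 1 / real q)" by simp
  also have "\<dots> \<le> (\<Prod>i\<in>UNIV. real (p i) / real (n i))"
    using ratio q by (intro prod_mono) auto
  also have "\<dots> = real (idx_size p) / real (idx_size n)" by (simp add: idx_size_def prod_dividef)
  finally have "real (idx_size n) - real (idx_size p) \<le> real CARD('d) / real q * real (idx_size n)"
    using npos by (simp add: idx_size_def field_simps prod_pos)
  also have "\<dots> \<le> real CARD('d) / real q * real (2 ^ CARD('d) * 2 ^ (\<Sum>i\<in>UNIV. m i))"
    using idx_size_block_le[OF n] by (intro mult_left_mono of_nat_mono) auto
  finally have "real (idx_size n) - real (idx_size p) \<le> real CARD('d) / real q * (2 ^ CARD('d) * 2 ^ (\<Sum>i\<in>UNIV. m i))"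
    by simp
  moreover have "card (Box n - Box p) = idx_size n - idx_size p"
    using p by (subst card_Diff_subset) (auto simp: card_Box intro!: Box_mono)
  moreover have "idx_size p \<le> idx_size n" by (rule idx_size_mono) (rule p)
  ultimately show ?thesis using that[of p] pb p by (auto simp: Grid_def of_nat_diff)
qed

section \<open>Almost sure bounds on blocks\<close>

text \<open>Taking the union over a whole level \<open>\<Sum>i. m i = s\<close> reduces the multiparameter
  Borel--Cantelli argument to the one for sequences.\<close>
lemma (in prob_space) AE_eventually_level:
  fixes A :: "('d::finite \<Rightarrow> nat) \<Rightarrow> 'a set"
  assumes A: "\<And>m. A m \<in> events"
    and f: "eventually (\<lambda>s. \<forall>m. (\<Sum>i\<in>UNIV. m i) = s \<longrightarrow> prob (A m) \<le> f s) sequentially"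
    and sm: "summable (\<lambda>s. (1 + real s) ^ (CARD('d) - 1) * f s)"
  shows "AE \<omega> in M. eventually (\<lambda>s. \<forall>m. (\<Sum>i\<in>UNIV. m i) = s \<longrightarrow> \<omega> \<notin> A m) sequentially"
proof -
  define L where "L s = {m :: 'd \<Rightarrow> nat. (\<Sum>i\<in>UNIV. m i) = s}" for s
  have finL: "finite (L s)" for s unfolding L_def by (rule card_level_le)
  define B where "B s = (\<Union>m\<in>L s. A m)" for s
  have B: "B s \<in> events" for s unfolding B_def using A finL by auto
  have "summable (\<lambda>s. prob (B s))"
  proof (rule summable_comparison_test_ev[OF _ sm])
    show "eventually (\<lambda>s. norm (prob (B s)) \<le> (1 + real s) ^ (CARD('d) - 1) * f s) sequentially"
      using f
    proof eventually_elim
      case (elim s)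
      have *: "prob (A m) \<le> f s" if "m \<in> L s" for m using elim that by (auto simp: L_def)
      \<comment> \<open>A nonempty level puts some probability below \<open>f s\<close>, whence
        \<open>0 \<le> f s\<close>; the cardinality factor can then be enlarged.\<close>
      have "L s \<noteq> {}"
      proof -
        obtain j :: 'd where True by simp
        have "(\<lambda>i. if i = j then s else 0) \<in> L s" by (simp add: L_def)
        then show ?thesis by blast
      qed
      then have f0: "0 \<le> f s" using * measure_nonneg order_trans by blast
      have "prob (B s) \<le> real (card (L s)) * f s"
        unfolding B_def using finL A * by (intro prob_UN_le) auto
      also have "real (card (L s)) \<le> real ((s + 1) ^ (CARD('d) - 1))"
        unfolding L_def using card_level_le(1)[where 'd = 'd, of s] by (rule of_nat_mono)
      finally show ?case using f0 by (simp add: mult_right_mono add.commute)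
    qed
  qed
  then have "AE \<omega> in M. eventually (\<lambda>s. \<omega> \<in> space M - B s) sequentially"
    by (intro borel_cantelli_AE1 B) (auto simp: emeasure_eq_measure)
  then show ?thesis
  proof (rule AE_mp, intro AE_I2 impI)
    fix \<omega> assume "eventually (\<lambda>s. \<omega> \<in> space M - B s) sequentially"
    then show "eventually (\<lambda>s. \<forall>m. (\<Sum>i\<in>UNIV. m i) = s \<longrightarrow> \<omega> \<notin> A m) sequentially"
      by eventually_elim (auto simp: B_def L_def)
  qed
qed

text \<open>About \<open>s ^ (d - 1)\<close> blocks on a level, each with a probability of order
  \<open>s powr (- \<theta>)\<close>: the series converges once \<open>\<theta> > d\<close>. This
  count of blocks is the source of the factor \<open>d\<close> in the normalisation.\<close>

lemma (in prob_space) AE_eventually_level_exp: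
  fixes A :: "('d::finite \<Rightarrow> nat) \<Rightarrow> 'a set"
  assumes A: "\<And>m. A m \<in> events" and \<theta>: "real CARD('d) < \<theta>"
    and f: "eventually (\<lambda>s. \<forall>m. (\<Sum>i\<in>UNIV. m i) = s \<longrightarrow> prob (A m) \<le> C * exp (- \<theta> * LL s)) sequentially"
  shows "AE \<omega> in M. eventually (\<lambda>s. \<forall>m. (\<Sum>i\<in>UNIV. m i) = s \<longrightarrow> \<omega> \<notin> A m) sequentially"
proof (rule AE_eventually_level[OF A f])
  define D where "D = CARD('d) - 1"
  have D: "real D = real CARD('d) - 1" unfolding D_def by (simp add: of_nat_diff Suc_leI)
  have "summable (\<lambda>n. real n powr (real D - \<theta>))"
    using \<theta> by (subst summable_real_powr_iff) (simp add: D)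
  then have "summable (\<lambda>n. real (Suc n) powr (real D - \<theta>))" by (subst summable_Suc_iff)
  then have sm: "summable (\<lambda>n. \<bar>C\<bar> * 2 powr \<theta> * real (Suc n) powr (real D - \<theta>))"
    by (rule summable_mult)
  show "summable (\<lambda>s. (1 + real s) ^ (CARD('d) - 1) * (C * exp (- \<theta> * LL s)))"
  proof (rule summable_comparison_test_ev[OF _ sm])
    show "eventually (\<lambda>s. norm ((1 + real s) ^ (CARD('d) - 1) * (C * exp (- \<theta> * LL s)))
        \<le> \<bar>C\<bar> * 2 powr \<theta> * real (Suc s) powr (real D - \<theta>)) sequentially"
      using eventually_ge_at_top[of 8]
    proof eventually_elim
      case (elim s)
      have "norm ((1 + real s) ^ D * (C * exp (- \<theta> * LL s)))
          = (1 + real s) ^ D * \<bar>C\<bar> * exp (- \<theta> * LL s)"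
        by (simp add: abs_mult)
      also have "\<dots> \<le> (1 + real s) ^ D * \<bar>C\<bar> * (2 powr \<theta> * (1 + real s) powr (- \<theta>))"
        using \<theta> elim by (intro mult_left_mono exp_LL_le) auto
      also have "\<dots> = \<bar>C\<bar> * 2 powr \<theta> * ((1 + real s) powr real D * (1 + real s) powr (- \<theta>))"
        by (simp add: powr_realpow mult_ac)
      also have "\<dots> = \<bar>C\<bar> * 2 powr \<theta> * real (Suc s) powr (real D - \<theta>)"
        by (simp add: powr_add[symmetric] add.commute)
      finally show ?case by (simp only: D_def)
    qed
  qed
qed

section \<open>The random field and consequences of its moment condition\<close>

locale na_lil = na_family M pos_idx X i1
  for M :: "'a measure" and X :: "('d::finite \<Rightarrow> nat) \<Rightarrow> 'a \<Rightarrow> real" and i1 :: "'d \<Rightarrow> nat" +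
  assumes dim: "2 \<le> CARD('d)"
    and X_int: "integrable M (X i1)"
    and X_mean: "expectation (X i1) = 0"
    and X_moment: "integrable M (\<lambda>\<omega>. (X i1 \<omega>)\<^sup>2 * (Log \<bar>X i1 \<omega>\<bar>) ^ (CARD('d) - 1)
                             / Log (Log \<bar>X i1 \<omega>\<bar>))"
begin

definition D :: nat where "D = CARD('d) - 1"

definition d :: real where "d = real CARD('d)"

abbreviation X1 :: "'a \<Rightarrow> real" where "X1 \<equiv> X i1"

definition \<sigma> :: real where "\<sigma> = sqrt (expectation (\<lambda>\<omega>. (X1 \<omega>)\<^sup>2))"

definition wsq :: "real \<Rightarrow> real" where "wsq x = x\<^sup>2 * Log \<bar>x\<bar> ^ D / Log (Log \<bar>x\<bar>)"

definition tail2 :: "real \<Rightarrow> real" where "tail2 u = expectation (\<lambda>\<omega>. if u < X1 \<omega> then (X1 \<omega>)\<^sup>2 else 0)"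

lemma D_pos: "0 < D" using dim by (simp add: D_def)

lemma d_ge_2: "2 \<le> d" using dim by (simp add: d_def)

lemma X1_meas [measurable]: "X1 \<in> borel_measurable M"
  using X_meas i0 by blast

lemma integrable_wsq: "integrable M (\<lambda>\<omega>. wsq (X1 \<omega>))"
  using X_moment by (simp add: wsq_def D_def)

lemma wsq_meas [measurable]: "wsq \<in> borel_measurable borel"
  unfolding wsq_def by measurable

lemma wsq_nonneg: "0 \<le> wsq x"
  unfolding wsq_def using Log_ge_1[of "\<bar>x\<bar>"] Log_ge_1[of "Log \<bar>x\<bar>"]
  by (intro divide_nonneg_nonneg mult_nonneg_nonneg) auto

text \<open>Since \<open>D \<ge> 1\<close> and \<open>Log y \<le> y\<close> for
  \<open>y \<ge> 1\<close>, the logarithmic weight is at least one; the moment condition therefore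
  implies finite variance.\<close>

lemma square_le_wsq: "x\<^sup>2 \<le> wsq x"
proof -
  have "Log (Log \<bar>x\<bar>) \<le> Log \<bar>x\<bar>" by (intro Log_le_self Log_ge_1)
  also have "\<dots> \<le> Log \<bar>x\<bar> ^ D" using D_pos Log_ge_1[of "\<bar>x\<bar>"] by (simp add: self_le_power)
  finally have "1 \<le> Log \<bar>x\<bar> ^ D / Log (Log \<bar>x\<bar>)"
    using Log_ge_1[of "Log \<bar>x\<bar>"] by (simp add: field_simps)
  from mult_left_mono[OF this, of "x\<^sup>2"] show ?thesis by (simp add: wsq_def)
qed

lemma integrable_square: "integrable M (\<lambda>\<omega>. (X1 \<omega>)\<^sup>2)"
  by (rule Bochner_Integration.integrable_bound[OF integrable_wsq]) (auto simp: wsq_nonneg square_le_wsq)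

lemma sigma2: "expectation (\<lambda>\<omega>. (X1 \<omega>)\<^sup>2) = \<sigma>\<^sup>2" "0 \<le> \<sigma>"
  by (simp_all add: \<sigma>_def)

lemma integrable_tail2: "integrable M (\<lambda>\<omega>. if u < X1 \<omega> then (X1 \<omega>)\<^sup>2 else 0)"
  by (rule Bochner_Integration.integrable_bound[OF integrable_square]) auto

lemma tail2_nonneg: "0 \<le> tail2 u"
  unfolding tail2_def by (intro Bochner_Integration.integral_nonneg) auto

text \<open>Beyond the truncation level the weight is at least a constant times
  \<open>s / LL s\<close>, so the left side is dominated by a tail of the integrable
  \<open>wsq\<close>, which vanishes by dominated convergence.\<close>

lemma tail_second_moment: "(\<lambda>s. real s / LL s * tail2 (trunc s)) \<longlonglongrightarrow> 0"
proof -
  obtain \<kappa> where \<kappa>: "\<kappa> > 0" and ev: "eventually (\<lambda>s. \<forall>x\<ge>2 powr (real s / 4).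
       \<kappa> * (1 + real s) ^ D / LL s \<le> Log x ^ D / Log (Log x)) sequentially"
    using moment_weight_ge[OF D_pos] by blast
  define J where "J s = expectation (\<lambda>\<omega>. if trunc s < X1 \<omega> then wsq (X1 \<omega>) else 0)" for s
  have "filterlim (\<lambda>s. 2 powr (real s / 4)) at_top sequentially" by real_asymp
  then have tr: "filterlim trunc at_top sequentially"
    by (rule filterlim_at_top_mono[OF _ eventually_trunc_ge])
  have "J \<longlonglongrightarrow> expectation (\<lambda>\<omega>. 0)"
    unfolding J_def
  proof (rule integral_dominated_convergence[where w = "\<lambda>\<omega>. wsq (X1 \<omega>)"])
    show "AE \<omega> in M. (\<lambda>s. if trunc s < X1 \<omega> then wsq (X1 \<omega>) else 0) \<longlonglongrightarrow> 0"
    proof (rule AE_I2)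
      fix \<omega>
      have "eventually (\<lambda>s. (if trunc s < X1 \<omega> then wsq (X1 \<omega>) else 0) = 0) sequentially"
        using tr[unfolded filterlim_at_top, rule_format, of "X1 \<omega>"] by eventually_elim auto
      then show "(\<lambda>s. if trunc s < X1 \<omega> then wsq (X1 \<omega>) else 0) \<longlonglongrightarrow> 0"
        by (rule tendsto_eventually)
    qed
  qed (auto simp: integrable_wsq wsq_nonneg)
  then have J: "(\<lambda>s. J s / \<kappa>) \<longlonglongrightarrow> 0" by (auto intro: tendsto_divide_zero)
  have le: "eventually (\<lambda>s. real s / LL s * tail2 (trunc s) \<le> J s / \<kappa>) sequentially"
    using ev eventually_trunc_ge eventually_gt_at_top[of 0]
  proof eventually_elim
    case (elim s)
    have "\<kappa> * (real s / LL s) * tail2 (trunc s)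
        = expectation (\<lambda>\<omega>. \<kappa> * (real s / LL s) * (if trunc s < X1 \<omega> then (X1 \<omega>)\<^sup>2 else 0))"
      unfolding tail2_def by simp
    also have "\<dots> \<le> J s"
      unfolding J_def
    proof (rule integral_mono)
      show "integrable M (\<lambda>\<omega>. \<kappa> * (real s / LL s) * (if trunc s < X1 \<omega> then (X1 \<omega>)\<^sup>2 else 0))"
        by (intro integrable_mult_right integrable_tail2)
      show "integrable M (\<lambda>\<omega>. if trunc s < X1 \<omega> then wsq (X1 \<omega>) else 0)"
        by (rule Bochner_Integration.integrable_bound[OF integrable_wsq]) (auto simp: wsq_nonneg)
      fix \<omega>
      show "\<kappa> * (real s / LL s) * (if trunc s < X1 \<omega> then (X1 \<omega>)\<^sup>2 else 0)
          \<le> (if trunc s < X1 \<omega> then wsq (X1 \<omega>) else 0)"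
      proof (cases "trunc s < X1 \<omega>")
        case True
        define x where "x = X1 \<omega>"
        have x: "trunc s < x" "0 < x" using True trunc_pos[of s] elim by (auto simp: x_def)
        \<comment> \<open>Of the \<open>D\<close> available powers of \<open>s\<close> one is kept:
          for \<open>d = 2\<close> there is no other, and it is the rate that the mean of the excess
          requires.\<close>
        have "real s \<le> (1 + real s) ^ 1" by simp
        also have "\<dots> \<le> (1 + real s) ^ D" using D_pos by (intro power_increasing) auto
        finally have "\<kappa> * (real s / LL s) \<le> \<kappa> * (1 + real s) ^ D / LL s"
          using \<kappa> LL_ge_1[of s] by (simp add: divide_right_mono)
        also have "\<dots> \<le> Log x ^ D / Log (Log x)" using elim x by auto
        finally have "x\<^sup>2 * (\<kappa> * (real s / LL s)) \<le> x\<^sup>2 * (Log x ^ D / Log (Log x))"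
          by (rule mult_left_mono) simp
        then show ?thesis using True x unfolding x_def[symmetric] by (simp add: wsq_def mult_ac)
      qed simp
    qed
    finally show ?case using \<kappa> by (simp add: field_simps)
  qed
  have nn: "eventually (\<lambda>s. 0 \<le> real s / LL s * tail2 (trunc s)) sequentially"
    using tail2_nonneg LL_ge_1 by (intro always_eventually allI mult_nonneg_nonneg divide_nonneg_nonneg) (auto intro: order_trans[OF zero_le_one])
  show ?thesis by (rule tendsto_sandwich[OF nn le tendsto_const J])
qed

text \<open>Exchange sum and expectation. For a fixed value \<open>x\<close> the terms with
  \<open>u s < x\<close> grow geometrically, so the largest such index \<open>S'\<close> dominates;
  writing \<open>2 ^ S'\<close> as \<open>(u S')\<^sup>2 / (c\<^sup>2 * LL S')\<close> and applying
  the weight bound at \<open>x\<close> leaves a multiple of \<open>wsq x\<close>.\<close>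

lemma summable_large:
  assumes c: "0 < c"
  shows "summable (\<lambda>s. (1 + real s) ^ D * (2 ^ s * prob {\<omega> \<in> space M. c * sqrt (2 ^ s * LL s) < X1 \<omega>}))"
    (is "summable ?f")
proof -
  obtain \<kappa> where \<kappa>: "\<kappa> > 0" and ev: "eventually (\<lambda>s. \<forall>x\<ge>2 powr (real s / 4).
       \<kappa> * (1 + real s) ^ D / LL s \<le> Log x ^ D / Log (Log x)) sequentially"
    using moment_weight_ge[OF D_pos] by blast
  define u where "u s = c * sqrt (2 ^ s * LL s)" for s
  obtain s1 where s1: "\<And>s x. s1 \<le> s \<Longrightarrow> 2 powr (real s / 4) \<le> x \<Longrightarrow>
       \<kappa> * (1 + real s) ^ D / LL s \<le> Log x ^ D / Log (Log x)"
      "\<And>s. s1 \<le> s \<Longrightarrow> 2 powr (real s / 4) \<le> u s"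
    using eventually_conj[OF ev eventually_sqrt_ge[OF c]] unfolding eventually_sequentially u_def by blast
  \<comment> \<open>The weight bound holds only from \<open>s1\<close> on; a shift of the index does
    not affect summability.\<close>
  define w where "w s = (1 + real (s + s1)) ^ D * 2 ^ (s + s1)" for s
  have pointwise: "(\<Sum>s<n. w s * (if u (s + s1) < x then 1 else 0)) \<le> 2 / (\<kappa> * c\<^sup>2) * wsq x" for n x
  proof -
    define F where "F = {s \<in> {..<n}. u (s + s1) < x}"
    have eq: "(\<Sum>s<n. w s * (if u (s + s1) < x then 1 else 0)) = (\<Sum>s\<in>F. w s)"
      unfolding F_def by (subst sum.inter_filter) (auto intro!: sum.cong)
    show ?thesis
    proof (cases "F = {}")
      case True
      then show ?thesis unfolding eq using \<kappa> by (simp add: wsq_nonneg)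
    next
      case False
      have finF: "finite F" by (simp add: F_def)
      define S where "S = Max F"
      have S: "S \<in> F" unfolding S_def by (rule Max_in[OF finF False])
      define S' where "S' = S + s1"
      have uS: "u S' < x" using S by (simp add: F_def S'_def)
      have "0 \<le> u S'" using c LL_ge_1[of S'] by (simp add: u_def)
      then have x: "0 < x" "(u S')\<^sup>2 \<le> x\<^sup>2" using uS by (auto intro: power_mono)
      have Lpos: "0 < LL S'" using LL_ge_1[of S'] by simp
      have u2: "(u S')\<^sup>2 = c\<^sup>2 * (2 ^ S' * LL S')" using Lpos by (simp add: u_def power_mult_distrib)
      have "(\<Sum>s\<in>F. w s) \<le> (\<Sum>s\<in>F. (1 + real S') ^ D * 2 ^ (s + s1))"
        unfolding w_def S'_def using finF
        by (intro sum_mono mult_right_mono power_mono) (auto simp: S_def)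
      also have "\<dots> \<le> (\<Sum>s\<in>{..S}. (1 + real S') ^ D * 2 ^ (s + s1))"
        using finF by (intro sum_mono2) (auto simp: S_def)
      also have "\<dots> = (1 + real S') ^ D * 2 ^ s1 * (\<Sum>s\<le>S. 2 ^ s)"
        by (subst sum_distrib_left) (simp add: power_add mult_ac)
      also have "(\<Sum>s\<le>S. 2 ^ s) = 2 ^ (S + 1) - (1 :: real)"
        by (induction S) auto
      also have "(1 + real S') ^ D * 2 ^ s1 * (2 ^ (S + 1) - 1) \<le> (1 + real S') ^ D * 2 ^ s1 * 2 ^ (S + 1)"
        by (intro mult_left_mono) auto
      also have "\<dots> = 2 / (\<kappa> * c\<^sup>2) * ((\<kappa> * (1 + real S') ^ D / LL S') * (u S')\<^sup>2)"
        unfolding u2 using Lpos \<kappa> c by (simp add: S'_def power_add field_simps)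
      also have "\<dots> \<le> 2 / (\<kappa> * c\<^sup>2) * ((Log x ^ D / Log (Log x)) * x\<^sup>2)"
      proof (intro mult_left_mono mult_mono)
        show "\<kappa> * (1 + real S') ^ D / LL S' \<le> Log x ^ D / Log (Log x)"
          using s1(1)[of S' x] s1(2)[of S'] uS by (simp add: S'_def)
        show "0 \<le> Log x ^ D / Log (Log x)"
          using Log_ge_1[of x] Log_ge_1[of "Log x"] by (intro divide_nonneg_nonneg) auto
      qed (use x \<kappa> in auto)
      also have "\<dots> = 2 / (\<kappa> * c\<^sup>2) * wsq x" using x by (simp add: wsq_def mult_ac)
      finally show ?thesis unfolding eq .
    qed
  qed
  have "summable (\<lambda>s. ?f (s + s1))"
  proof (rule summableI_nonneg_bounded)
    fix n
    define E where "E s = {\<omega> \<in> space M. u s < X1 \<omega>}" for s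
    have E [measurable]: "E s \<in> events" for s unfolding E_def by measurable
    have "(\<Sum>s<n. ?f (s + s1)) = (\<Sum>s<n. expectation (\<lambda>\<omega>. w s * indicator (E (s + s1)) \<omega>))"
      by (simp add: w_def E_def u_def mult.assoc)
    also have "\<dots> = expectation (\<lambda>\<omega>. \<Sum>s<n. w s * indicator (E (s + s1)) \<omega>)"
      by (intro Bochner_Integration.integral_sum[symmetric] integrable_mult_right integrable_real_indicator)
         (auto simp: emeasure_eq_measure)
    also have "\<dots> \<le> expectation (\<lambda>\<omega>. 2 / (\<kappa> * c\<^sup>2) * wsq (X1 \<omega>))"
    proof (rule integral_mono)
      show "integrable M (\<lambda>\<omega>. \<Sum>s<n. w s * indicator (E (s + s1)) \<omega>)"
        by (intro Bochner_Integration.integrable_sum integrable_mult_right integrable_real_indicator)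
         (auto simp: emeasure_eq_measure)
      show "integrable M (\<lambda>\<omega>. 2 / (\<kappa> * c\<^sup>2) * wsq (X1 \<omega>))"
        by (intro integrable_mult_right integrable_wsq)
      fix \<omega> assume "\<omega> \<in> space M"
      then have "(\<Sum>s<n. w s * indicator (E (s + s1)) \<omega>) = (\<Sum>s<n. w s * (if u (s + s1) < X1 \<omega> then 1 else 0))"
        by (intro sum.cong) (auto simp: E_def indicator_def)
      then show "(\<Sum>s<n. w s * indicator (E (s + s1)) \<omega>) \<le> 2 / (\<kappa> * c\<^sup>2) * wsq (X1 \<omega>)"
        using pointwise by simp
    qed
    finally show "(\<Sum>s<n. ?f (s + s1)) \<le> expectation (\<lambda>\<omega>. 2 / (\<kappa> * c\<^sup>2) * wsq (X1 \<omega>))" .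
  qed simp
  then show ?thesis by (subst (asm) summable_iff_shift)
qed

section \<open>Large values and the truncated excess\<close>

lemma AE_large:
  assumes c: "0 < c"
  shows "AE \<omega> in M. eventually (\<lambda>s. \<forall>m. (\<Sum>i\<in>UNIV. m i) = s \<longrightarrow>
    (\<forall>k\<in>block m. X k \<omega> \<le> c * sqrt (2 ^ s * LL s))) sequentially"
proof -
  define u where "u s = c * sqrt (2 ^ s * LL s)" for s
  define E where "E k s = {\<omega> \<in> space M. u s < X k \<omega>}" for k :: "'d \<Rightarrow> nat" and s
  define A where "A m = (\<Union>k\<in>block m. E k (\<Sum>i\<in>UNIV. m i))" for m :: "'d \<Rightarrow> nat"
  have Xk: "X k \<in> borel_measurable M" if "k \<in> block m" for k m
    using that block_subset_pos_idx X_meas by blast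
  have E: "E k s \<in> events" if "k \<in> block m" for k m s
    unfolding E_def using Xk[OF that] by measurable
  have A: "A m \<in> events" for m unfolding A_def using E by (intro sets.finite_UN) auto
  have "AE \<omega> in M. eventually (\<lambda>s. \<forall>m. (\<Sum>i\<in>UNIV. m i) = s \<longrightarrow> \<omega> \<notin> A m) sequentially"
  proof (rule AE_eventually_level[OF A always_eventually])
    show "summable (\<lambda>s. (1 + real s) ^ (CARD('d) - 1) * (2 ^ s * prob {\<omega> \<in> space M. u s < X1 \<omega>}))"
      using summable_large[OF c] by (simp add: D_def u_def)
    show "\<forall>s m. (\<Sum>i\<in>UNIV. m i) = s \<longrightarrow> prob (A m) \<le> 2 ^ s * prob {\<omega> \<in> space M. u s < X1 \<omega>}"
    proof (intro allI impI)
      fix s and m :: "'d \<Rightarrow> nat" assume m: "(\<Sum>i\<in>UNIV. m i) = s"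
      have "prob (E k s) = prob {\<omega> \<in> space M. u s < X1 \<omega>}" if "k \<in> block m" for k
      proof -
        have "prob (E k s) = expectation (\<lambda>\<omega>. indicator {u s<..} (X k \<omega>))"
          using E[OF that] by (subst Bochner_Integration.integral_cong[OF refl, where g = "indicator (E k s)"])
            (auto simp: E_def indicator_def)
        also have "\<dots> = expectation (\<lambda>\<omega>. indicator {u s<..} (X1 \<omega>))"
          using that block_subset_pos_idx by (intro expectation_ident) auto
        also have "\<dots> = prob {\<omega> \<in> space M. u s < X1 \<omega>}"
          by (subst Bochner_Integration.integral_cong[OF refl, where g = "indicator {\<omega> \<in> space M. u s < X1 \<omega>}"])
            (auto simp: indicator_def Int_absorb2)
        finally show ?thesis .
      qed
      \<comment> \<open>The union runs over all \<open>2 ^ s\<close> indices of the block, which is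
        the factor \<open>2 ^ s\<close> in the summable series.\<close>
      then have "prob (A m) \<le> real (card (block m)) * prob {\<omega> \<in> space M. u s < X1 \<omega>}"
        unfolding A_def m using E by (intro prob_UN_le) auto
      then show "prob (A m) \<le> 2 ^ s * prob {\<omega> \<in> space M. u s < X1 \<omega>}" by (simp add: card_block m)
    qed
  qed
  then show ?thesis
  proof (rule AE_mp, intro AE_I2 impI)
    fix \<omega> assume \<omega>: "\<omega> \<in> space M"
    assume "eventually (\<lambda>s. \<forall>m. (\<Sum>i\<in>UNIV. m i) = s \<longrightarrow> \<omega> \<notin> A m) sequentially"
    then show "eventually (\<lambda>s. \<forall>m. (\<Sum>i\<in>UNIV. m i) = s \<longrightarrow>
        (\<forall>k\<in>block m. X k \<omega> \<le> c * sqrt (2 ^ s * LL s))) sequentially"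
      by eventually_elim (use \<omega> in \<open>auto simp: A_def E_def u_def not_less\<close>)
  qed
qed

text \<open>Complements \<open>min x a\<close>: for nonnegative \<open>b\<close> the two add up to
  \<open>x\<close> whenever \<open>x - a \<le> b\<close>. It is nonnegative and bounded by
  \<open>b\<close>, and nondecreasing in \<open>x\<close>, as negative association demands.\<close>

definition excess :: "real \<Rightarrow> real \<Rightarrow> real \<Rightarrow> real" where
  "excess a b x = min (max (x - a) 0) b"

text \<open>The rectangle with sides \<open>2 ^ (m i + 1)\<close> contains \<open>Box n\<close> for
  all \<open>n\<close> of the block, so by nonnegativity it controls them all. Mean and second
  moment of the excess are at most \<open>tail2 a / a\<close> and \<open>tail2 a\<close>. With
  \<open>c = \<epsilon> / (8 * d)\<close> the Chernoff exponent starts at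
  \<open>- 4 * d * L\<close>; the mean uses up half of it, and \<open>2 * d\<close> still exceeds
  \<open>d\<close>.\<close>

lemma AE_medium:
  assumes \<epsilon>: "0 < \<epsilon>" and c_def: "c = \<epsilon> / (8 * d)"
  shows "AE \<omega> in M. eventually (\<lambda>s. \<forall>m. (\<Sum>i\<in>UNIV. m i) = s \<longrightarrow>
    (\<Sum>k\<in>Box (\<lambda>i. 2 ^ (m i + 1)). excess (trunc s) (c * sqrt (2 ^ s * LL s)) (X k \<omega>))
      < \<epsilon> * sqrt (2 ^ s * LL s)) sequentially"
proof -
  define R where "R s = sqrt (2 ^ s * LL s)" for s
  define A where "A m = (let s = \<Sum>i\<in>UNIV. m i in {\<omega> \<in> space M.
     \<epsilon> * R s \<le> (\<Sum>k\<in>Box (\<lambda>i. 2 ^ (m i + 1)). excess (trunc s) (c * R s) (X k \<omega>))})" for m :: "'d \<Rightarrow> nat"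
  have c: "0 < c" using \<epsilon> d_ge_2 by (simp add: c_def)
  have Xm: "X k \<in> borel_measurable M" if "k \<in> Box n" for k n
    using that Box_subset_pos_idx X_meas by blast
  have A: "A m \<in> events" for m
    unfolding A_def Let_def excess_def using Xm
    by (intro borel_measurable_le borel_measurable_const borel_measurable_sum borel_measurable_min
      borel_measurable_max borel_measurable_diff)
  define K where "K = (2::real) ^ CARD('d)"
  have K: "0 < K" by (simp add: K_def)
  \<comment> \<open>The first threshold keeps the mean term below half of the main term; the second,
    \<open>s * t < L\<close>, serves the variance term.\<close>
  have ev1: "eventually (\<lambda>s. real s / LL s * tail2 (trunc s) < \<epsilon> / (2 * K)) sequentially"
    using \<epsilon> K by (intro order_tendstoD(2)[OF tail_second_moment]) simp
  have ev2: "eventually (\<lambda>s. real s / LL s * tail2 (trunc s) < 1) sequentially"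
    by (intro order_tendstoD(2)[OF tail_second_moment]) simp
  have "((\<lambda>x. K / (8 * c\<^sup>2) * (x\<^sup>2 * exp (- x / 2))) \<longlongrightarrow> 0) at_top" by real_asymp
  from filterlim_compose[OF this LL_at_top]
  have ev3: "eventually (\<lambda>s. K / (8 * c\<^sup>2) * ((LL s)\<^sup>2 * exp (- LL s / 2)) < 1) sequentially"
    by (rule order_tendstoD(2)) simp
  have "eventually (\<lambda>s. \<forall>m. (\<Sum>i\<in>UNIV. m i) = s \<longrightarrow> prob (A m) \<le> exp 1 * exp (- (2 * d) * LL s)) sequentially"
    using ev1 ev2 ev3 eventually_ge_at_top[of 8]
  proof eventually_elim
    case (elim s)
    show ?case
    proof (intro allI impI)
      fix m :: "'d \<Rightarrow> nat" assume m: "(\<Sum>i\<in>UNIV. m i) = s"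
      define L r a b t where "L = LL s" and "r = R s" and "a = trunc s" and "b = c * r" and "t = tail2 a"
      \<comment> \<open>Now \<open>exp (l * b) = exp (L / 2)\<close> grows only like the square root
        of \<open>s\<close>, which the decay of \<open>t\<close> outweighs.\<close>
      define l where "l = L / (2 * b)"
      have s: "0 < real s" using elim by simp
      have L: "1 \<le> L" using LL_ge_1 by (simp add: L_def)
      have r2: "2 ^ s = r\<^sup>2 / L" using L by (simp add: r_def R_def L_def)
      have r: "0 < r" using L by (simp add: r_def R_def L_def[symmetric])
      have a: "a = r / real s" by (simp add: a_def trunc_def r_def R_def)
      have apos: "0 < a" using r s by (simp add: a)
      have b: "0 < b" using c r by (simp add: b_def)
      have t0: "0 \<le> t" by (simp add: t_def tail2_nonneg)
      have st: "real s * t < \<epsilon> / (2 * K) * L" "real s * t < 1 * L"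
        using elim L by (simp_all add: t_def a_def L_def[symmetric] field_simps)
      have ex: "excess a b x \<le> b" "0 \<le> excess a b x" for x using b by (auto simp: excess_def)
      have mono: "mono (excess a b)" by (auto simp: mono_def excess_def)
      then have em [measurable]: "excess a b \<in> borel_measurable borel" by (rule borel_measurable_mono)
      have ex1: "excess a b x \<le> (if a < x then x\<^sup>2 else 0) / a" for x
      proof (cases "a < x")
        case True
        have "excess a b x \<le> x" using True apos by (auto simp: excess_def)
        also have "x \<le> x\<^sup>2 / a" using True apos by (simp add: power2_eq_square field_simps)
        finally show ?thesis using True by simp
      qed (auto simp: excess_def)
      have ex2: "(excess a b x)\<^sup>2 \<le> (if a < x then x\<^sup>2 else 0)" for x
      proof (cases "a < x")
        case True
        have "excess a b x \<le> x" using True apos by (auto simp: excess_def)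
        then show ?thesis using True ex(2)[of x] by (simp add: power_mono)
      next
        case False
        then have "excess a b x = 0" using b by (simp add: excess_def)
        then show ?thesis by simp
      qed
      have int1: "integrable M (\<lambda>\<omega>. excess a b (X1 \<omega>))"
        by (rule integrable_const_bound[where B = b]) (auto simp: ex)
      have int2: "integrable M (\<lambda>\<omega>. (excess a b (X1 \<omega>))\<^sup>2)"
        by (rule integrable_const_bound[where B = "b\<^sup>2"]) (auto simp: ex intro!: AE_I2 power_mono)
      have "prob (A m) \<le> exp (- l * (\<epsilon> * r) + real (card (Box (\<lambda>i. 2 ^ (m i + 1))))
            * (l * (t / a) + l\<^sup>2 / 2 * exp (l * b) * t))"
        unfolding A_def Let_def m r_def[symmetric] a_def[symmetric] b_def[symmetric]
      proof (rule prob_sum_ge[OF mono ex(1) less_imp_le[OF b] int1 int2])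
        have "expectation (\<lambda>\<omega>. excess a b (X1 \<omega>)) \<le> expectation (\<lambda>\<omega>. (if a < X1 \<omega> then (X1 \<omega>)\<^sup>2 else 0) / a)"
          using ex1 by (intro integral_mono int1 integrable_divide integrable_tail2)
        then show "expectation (\<lambda>\<omega>. excess a b (X1 \<omega>)) \<le> t / a"
          by (simp add: t_def tail2_def)
        show "expectation (\<lambda>\<omega>. (excess a b (X1 \<omega>))\<^sup>2) \<le> t"
          unfolding t_def tail2_def using ex2 by (intro integral_mono int2 integrable_tail2)
      qed (use b L in \<open>auto simp: l_def Box_subset_pos_idx\<close>)
      also have "real (card (Box (\<lambda>i. 2 ^ (m i + 1)))) = K * (r\<^sup>2 / L)"
        unfolding card_Box idx_size_Suc_pow m by (simp add: K_def r2)
      also have "l * b = L / 2" using b by (simp add: l_def)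
      also have "- l * (\<epsilon> * r) + K * (r\<^sup>2 / L) * (l * (t / a) + l\<^sup>2 / 2 * exp (L / 2) * t)
          = - (\<epsilon> * L / (2 * c)) + K / (2 * c) * (real s * t) + K / (8 * c\<^sup>2) * (L * exp (L / 2) * t)"
        using r L c s unfolding l_def b_def a by (simp add: field_simps power2_eq_square)
      also have "\<dots> \<le> - (\<epsilon> * L / (2 * c)) + \<epsilon> * L / (4 * c) + 1"
      proof (intro add_mono order_refl)
        have "K / (2 * c) * (real s * t) \<le> K / (2 * c) * (\<epsilon> / (2 * K) * L)"
          using K c st by (intro mult_left_mono) auto
        also have "\<dots> = \<epsilon> * L / (4 * c)" using K c by (simp add: field_simps)
        finally show "K / (2 * c) * (real s * t) \<le> \<epsilon> * L / (4 * c)" .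
        \<comment> \<open>With \<open>s * t < L\<close> this yields
          \<open>t \<le> L * exp (- L)\<close>, so the variance term is a multiple of
          \<open>L\<^sup>2 * exp (- L / 2)\<close>.\<close>
        have "exp L * t \<le> real s * t"
          using le_exp_LL(2)[of s] elim t0 by (intro mult_right_mono) (auto simp: L_def)
        then have "t \<le> L * exp (- L)" using st(2) by (simp add: exp_minus field_simps)
        then have "K / (8 * c\<^sup>2) * (L * exp (L / 2) * t) \<le> K / (8 * c\<^sup>2) * (L * exp (L / 2) * (L * exp (- L)))"
          using K L by (intro mult_left_mono) auto
        also have "L * exp (L / 2) * (L * exp (- L)) = L\<^sup>2 * (exp (L / 2) * exp (- L))"
          by (simp add: power2_eq_square mult_ac)
        also have "exp (L / 2) * exp (- L) = exp (- L / 2)" by (simp add: exp_add[symmetric])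
        also have "K / (8 * c\<^sup>2) * (L\<^sup>2 * exp (- L / 2)) \<le> 1" using elim by (simp add: L_def)
        finally show "K / (8 * c\<^sup>2) * (L * exp (L / 2) * t) \<le> 1" .
      qed
      also have "- (\<epsilon> * L / (2 * c)) + \<epsilon> * L / (4 * c) + 1 = 1 + - (2 * d) * LL s"
        using \<epsilon> d_ge_2 unfolding c_def L_def by (simp add: field_simps)
      finally show "prob (A m) \<le> exp 1 * exp (- (2 * d) * LL s)" by (simp add: exp_add[symmetric])
    qed
  qed
  then have "AE \<omega> in M. eventually (\<lambda>s. \<forall>m. (\<Sum>i\<in>UNIV. m i) = s \<longrightarrow> \<omega> \<notin> A m) sequentially"
    using d_ge_2 by (intro AE_eventually_level_exp[OF A]) (auto simp: d_def)
  then show ?thesis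
  proof (rule AE_mp, intro AE_I2 impI)
    fix \<omega> assume \<omega>: "\<omega> \<in> space M"
    assume "eventually (\<lambda>s. \<forall>m. (\<Sum>i\<in>UNIV. m i) = s \<longrightarrow> \<omega> \<notin> A m) sequentially"
    then show "eventually (\<lambda>s. \<forall>m. (\<Sum>i\<in>UNIV. m i) = s \<longrightarrow>
       (\<Sum>k\<in>Box (\<lambda>i. 2 ^ (m i + 1)). excess (trunc s) (c * sqrt (2 ^ s * LL s)) (X k \<omega>))
         < \<epsilon> * sqrt (2 ^ s * LL s)) sequentially"
      by eventually_elim (use \<omega> in \<open>auto simp: A_def R_def not_le Let_def\<close>)
  qed
qed

section \<open>Chaining for sums truncated from above\<close>

lemma prob_sum_min_ge:
  assumes a: "0 \<le> a" and l: "0 \<le> l" and A: "finite A" "A \<subseteq> pos_idx" "real (card A) \<le> r"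
  shows "prob {\<omega> \<in> space M. t \<le> (\<Sum>k\<in>A. min (X k \<omega>) a)}
    \<le> exp (- l * t + r * (l\<^sup>2 / 2 * exp (l * a) * \<sigma>\<^sup>2))"
proof -
  have int1: "integrable M (\<lambda>\<omega>. min (X1 \<omega>) a)" by (intro Bochner_Integration.integrable_min X_int) auto
  have sq: "(min x a)\<^sup>2 \<le> x\<^sup>2" for x using a by (auto simp: min_def intro: power_mono)
  have int2: "integrable M (\<lambda>\<omega>. (min (X1 \<omega>) a)\<^sup>2)"
    by (rule Bochner_Integration.integrable_bound[OF integrable_square]) (auto simp: sq)
  have "prob {\<omega> \<in> space M. t \<le> (\<Sum>k\<in>A. min (X k \<omega>) a)}
      \<le> exp (- l * t + real (card A) * (l * 0 + l\<^sup>2 / 2 * exp (l * a) * \<sigma>\<^sup>2))"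
  proof (rule prob_sum_ge)
    show "mono (\<lambda>x. min x a)" by (auto simp: mono_def)
    \<comment> \<open>Truncation from above only lowers the mean, so the linear term drops out
      without centring.\<close>
    have "expectation (\<lambda>\<omega>. min (X1 \<omega>) a) \<le> expectation X1" by (intro integral_mono int1 X_int) auto
    then show "expectation (\<lambda>\<omega>. min (X1 \<omega>) a) \<le> 0" by (simp add: X_mean)
    show "expectation (\<lambda>\<omega>. (min (X1 \<omega>) a)\<^sup>2) \<le> \<sigma>\<^sup>2"
      unfolding sigma2(1)[symmetric] by (intro integral_mono int2 integrable_square sq)
  qed (use assms int1 int2 in auto)
  also have "\<dots> \<le> exp (- l * t + r * (l\<^sup>2 / 2 * exp (l * a) * \<sigma>\<^sup>2))"
    using A by (auto intro!: mult_right_mono)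
  finally show ?thesis .
qed

lemma sum_min_measurable:
  "A \<subseteq> pos_idx \<Longrightarrow> (\<lambda>\<omega>. \<Sum>k\<in>A. min (X k \<omega>) a) \<in> borel_measurable M"
  using X_meas by (intro borel_measurable_sum borel_measurable_min) auto

lemma prob_increments_ge:
  assumes a: "0 \<le> a" and l: "0 \<le> l" and P: "finite P" "finite Q"
  shows "prob (\<Union>z\<in>{z\<in>P \<times> Q. real (card (Box (fst z) - Box (snd z))) \<le> r}.
      {\<omega> \<in> space M. t \<le> (\<Sum>k\<in>Box (fst z) - Box (snd z). min (X k \<omega>) a)})
    \<le> real (card P) * real (card Q) * exp (- l * t + r * (l\<^sup>2 / 2 * exp (l * a) * \<sigma>\<^sup>2))"
    (is "prob (\<Union>z\<in>?Z. _) \<le> _ * ?e")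
proof -
  have sub: "Box p - Box q \<subseteq> pos_idx" for p q :: "'d \<Rightarrow> nat" using Box_subset_pos_idx by blast
  have fin: "finite ?Z" using P by auto
  have "prob (\<Union>z\<in>?Z. {\<omega> \<in> space M. t \<le> (\<Sum>k\<in>Box (fst z) - Box (snd z). min (X k \<omega>) a)})
      \<le> real (card ?Z) * ?e"
  proof (rule prob_UN_le[OF fin])
    show "{\<omega> \<in> space M. t \<le> (\<Sum>k\<in>Box (fst z) - Box (snd z). min (X k \<omega>) a)} \<in> events" for z
      by (intro borel_measurable_le borel_measurable_const sum_min_measurable sub)
    fix z assume "z \<in> ?Z"
    then have z: "real (card (Box (fst z) - Box (snd z))) \<le> r" by blast
    show "prob {\<omega> \<in> space M. t \<le> (\<Sum>k\<in>Box (fst z) - Box (snd z). min (X k \<omega>) a)} \<le> ?e"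
      by (rule prob_sum_min_ge[OF a l _ sub z]) simp
  qed
  also have "real (card ?Z) \<le> real (card P) * real (card Q)"
    using card_mono[of "P \<times> Q" ?Z] P by (auto simp: card_cartesian_product simp flip: of_nat_mult)
  finally show ?thesis by (simp add: mult_right_mono)
qed

text \<open>Borel-Cantelli step shared by both chaining steps: \<open>P\<close> and \<open>Q\<close>
  supply the outer and inner corners, \<open>r\<close> bounds the size of the increment, and
  \<open>l\<close> is the Chernoff parameter. The union bound costs the number of corner pairs; the
  target rate \<open>2 * d\<close> is simply one that exceeds \<open>d\<close>.\<close>

lemma AE_increments:
  fixes P Q :: "nat \<Rightarrow> ('d \<Rightarrow> nat) \<Rightarrow> ('d \<Rightarrow> nat) set" and l r :: "nat \<Rightarrow> real"
  assumes fin: "\<And>s m. finite (P s m)" "\<And>s m. finite (Q s m)"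
    and ev: "eventually (\<lambda>s. \<forall>m. (\<Sum>i\<in>UNIV. m i) = s \<longrightarrow> 0 \<le> l s \<and>
      real (card (P s m)) * real (card (Q s m)) * exp (- l s * (\<epsilon> * sqrt (2 ^ s * LL s)) + r s * ((l s)\<^sup>2 / 2 * exp (l s * trunc s) * \<sigma>\<^sup>2))
      \<le> C * exp (- (2 * d) * LL s)) sequentially"
  shows "AE \<omega> in M. eventually (\<lambda>s. \<forall>m. (\<Sum>i\<in>UNIV. m i) = s \<longrightarrow>
    (\<forall>p\<in>P s m. \<forall>q\<in>Q s m. real (card (Box p - Box q)) \<le> r s \<longrightarrow>
      (\<Sum>k\<in>Box p - Box q. min (X k \<omega>) (trunc s)) < \<epsilon> * sqrt (2 ^ s * LL s))) sequentially"
proof -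
  define Z where "Z m = {z\<in>P (\<Sum>i\<in>UNIV. m i) m \<times> Q (\<Sum>i\<in>UNIV. m i) m. real (card (Box (fst z) - Box (snd z))) \<le> r (\<Sum>i\<in>UNIV. m i)}" for m
  define A where "A m = (\<Union>z\<in>Z m. {\<omega> \<in> space M. \<epsilon> * sqrt (2 ^ (\<Sum>i\<in>UNIV. m i) * LL (\<Sum>i\<in>UNIV. m i))
      \<le> (\<Sum>k\<in>Box (fst z) - Box (snd z). min (X k \<omega>) (trunc (\<Sum>i\<in>UNIV. m i)))})" for m
  have sub: "Box p - Box q \<subseteq> pos_idx" for p q :: "'d \<Rightarrow> nat" using Box_subset_pos_idx by blast
  have "finite (Z m)" for m using fin by (auto simp: Z_def)
  then have A: "A m \<in> events" for m
    unfolding A_def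
    by (intro sets.finite_UN borel_measurable_le borel_measurable_const sum_min_measurable sub)
  have "eventually (\<lambda>s. \<forall>m. (\<Sum>i\<in>UNIV. m i) = s \<longrightarrow> prob (A m) \<le> C * exp (- (2 * d) * LL s)) sequentially"
    using ev eventually_gt_at_top[of 0]
  proof eventually_elim
    case (elim s)
    show ?case
    proof (intro allI impI)
      fix m :: "'d \<Rightarrow> nat" assume m: "(\<Sum>i\<in>UNIV. m i) = s"
      have "0 \<le> trunc s" "0 \<le> l s" using elim m trunc_pos[of s] by auto
      then show "prob (A m) \<le> C * exp (- (2 * d) * LL s)"
        unfolding A_def Z_def m by (rule order_trans[OF prob_increments_ge[OF _ _ fin]]) (use elim m in blast)
    qed
  qed
  then have "AE \<omega> in M. eventually (\<lambda>s. \<forall>m. (\<Sum>i\<in>UNIV. m i) = s \<longrightarrow> \<omega> \<notin> A m) sequentially"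
    using d_ge_2 by (intro AE_eventually_level_exp[OF A]) (auto simp: d_def)
  then show ?thesis
  proof (rule AE_mp, intro AE_I2 impI)
    fix \<omega> assume \<omega>: "\<omega> \<in> space M"
    assume "eventually (\<lambda>s. \<forall>m. (\<Sum>i\<in>UNIV. m i) = s \<longrightarrow> \<omega> \<notin> A m) sequentially"
    then show "eventually (\<lambda>s. \<forall>m :: 'd \<Rightarrow> nat. (\<Sum>i\<in>UNIV. m i) = s \<longrightarrow>
      (\<forall>p\<in>P s m. \<forall>q\<in>Q s m. real (card (Box p - Box q)) \<le> r s \<longrightarrow>
        (\<Sum>k\<in>Box p - Box q. min (X k \<omega>) (trunc s)) < \<epsilon> * sqrt (2 ^ s * LL s))) sequentially"
    proof eventually_elim
      case (elim s)
      then show ?case using \<omega> by (fastforce simp: A_def Z_def not_less)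
    qed
  qed
qed

lemma pow_card_le:
  assumes "8 \<le> s" shows "real (s ^ CARD('d)) \<le> 2 ^ CARD('d) * exp (d * LL s)"
proof -
  have "real s ^ CARD('d) \<le> (2 * exp (LL s)) ^ CARD('d)"
    using le_exp_LL(1)[OF assms] by (intro power_mono) auto
  then show ?thesis by (simp add: power_mult_distrib d_def exp_of_nat_mult[symmetric])
qed

text \<open>First chaining step: each increment covers a fraction of order \<open>1 / q\<close> of the block, so that the
  exponent gained for \<open>q\<close> large pays for the polynomially many (in \<open>s\<close>) pairs of grid points.\<close>
lemma AE_coarse_increments:
  assumes \<epsilon>: "0 < \<epsilon>"
  obtains q where "0 < q"
    "AE \<omega> in M. eventually (\<lambda>s. \<forall>m. (\<Sum>i\<in>UNIV. m i) = s \<longrightarrow>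
      (\<forall>p\<in>Grid m s. \<forall>p'\<in>Grid m q. real (card (Box p - Box p')) \<le> d / real q * (2 ^ CARD('d) * 2 ^ s) \<longrightarrow>
        (\<Sum>k\<in>Box p - Box p'. min (X k \<omega>) (trunc s)) < \<epsilon> * sqrt (2 ^ s * LL s))) sequentially"
proof -
  define K where "K = (2::real) ^ CARD('d)"
  have K: "0 < K" by (simp add: K_def)
  \<comment> \<open>With \<open>l = \<Lambda> * L / r\<close> the linear term is
    \<open>- 4 * d * L\<close>. The \<open>s ^ d\<close> grid points cost \<open>d * L\<close>, the
    variance term at most another \<open>d * L\<close>, and \<open>- 2 * d * L\<close>
    remains.\<close>
  define \<Lambda> where "\<Lambda> = 4 * d / \<epsilon>"
  have \<Lambda>: "0 < \<Lambda>" using \<epsilon> d_ge_2 by (simp add: \<Lambda>_def)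
  \<comment> \<open>Chosen so that the variance term is at most \<open>d * L\<close>; the factor
    \<open>exp 1\<close> covers \<open>exp (l * trunc s)\<close>, whose exponent
    \<open>\<Lambda> * L / s\<close> is eventually below one.\<close>
  define q where "q = Suc (nat \<lceil>K * \<Lambda>\<^sup>2 / 2 * exp 1 * \<sigma>\<^sup>2\<rceil>)"
  have q: "K * \<Lambda>\<^sup>2 / 2 * exp 1 * \<sigma>\<^sup>2 \<le> real q" "0 < q"
    unfolding q_def by linarith+
  have "(\<lambda>s. \<Lambda> * (LL s / real s)) \<longlonglongrightarrow> \<Lambda> * 0" by (intro tendsto_mult tendsto_const LL_over_s)
  then have ev1: "eventually (\<lambda>s. \<Lambda> * (LL s / real s) < 1) sequentially"
    by (intro order_tendstoD(2)) auto
  show ?thesis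
  proof (rule that[OF q(2)], rule AE_increments[where P = "\<lambda>s m. Grid m s" and Q = "\<lambda>s m. Grid m q"])
    show "eventually (\<lambda>s. \<forall>m :: 'd \<Rightarrow> nat. (\<Sum>i\<in>UNIV. m i) = s \<longrightarrow> 0 \<le> \<Lambda> * LL s / sqrt (2 ^ s * LL s) \<and>
      real (card (Grid m s)) * real (card (Grid m q)) *
      exp (- (\<Lambda> * LL s / sqrt (2 ^ s * LL s)) * (\<epsilon> * sqrt (2 ^ s * LL s))
        + d / real q * (2 ^ CARD('d) * 2 ^ s) *
          ((\<Lambda> * LL s / sqrt (2 ^ s * LL s))\<^sup>2 / 2 * exp (\<Lambda> * LL s / sqrt (2 ^ s * LL s) * trunc s) * \<sigma>\<^sup>2))
      \<le> (K * real q ^ CARD('d)) * exp (- (2 * d) * LL s)) sequentially"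
      using ev1 eventually_ge_at_top[of 8]
    proof eventually_elim
      case (elim s)
      define L r where "L = LL s" and "r = sqrt (2 ^ s * LL s)"
      have L: "1 \<le> L" using LL_ge_1 by (simp add: L_def)
      have r2: "2 ^ s = r\<^sup>2 / L" using L by (simp add: r_def L_def)
      have r: "0 < r" using L by (simp add: r_def L_def[symmetric])
      have a: "trunc s = r / real s" by (simp add: trunc_def r_def)
      have s: "0 < real s" using elim by simp
      show ?case
      proof (intro allI impI conjI)
        show "0 \<le> \<Lambda> * LL s / sqrt (2 ^ s * LL s)" using \<Lambda> L by (simp add: L_def)
        fix m :: "'d \<Rightarrow> nat" assume m: "(\<Sum>i\<in>UNIV. m i) = s"
        have "d / real q * (K * (r\<^sup>2 / L)) * ((\<Lambda> * L / r)\<^sup>2 / 2 * exp (\<Lambda> * L / r * (r / real s)) * \<sigma>\<^sup>2)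
            \<le> d / real q * (K * (r\<^sup>2 / L)) * ((\<Lambda> * L / r)\<^sup>2 / 2 * exp 1 * \<sigma>\<^sup>2)"
          using elim r L K d_ge_2 by (intro mult_left_mono mult_right_mono) (auto simp: L_def)
        also have "\<dots> = d * L * ((K * \<Lambda>\<^sup>2 / 2 * exp 1 * \<sigma>\<^sup>2) / real q)"
          using r L q(2) by (simp add: field_simps power2_eq_square)
        also have "\<dots> \<le> d * L * 1"
          using q L d_ge_2 by (intro mult_left_mono) auto
        finally have e: "d / real q * (K * (r\<^sup>2 / L)) * ((\<Lambda> * L / r)\<^sup>2 / 2 * exp (\<Lambda> * L / r * (r / real s)) * \<sigma>\<^sup>2) \<le> d * L"
          by simp
        have e2: "- (\<Lambda> * L / r) * (\<epsilon> * r) = - (4 * d * L)" using r \<epsilon> by (simp add: \<Lambda>_def)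
        have "real (card (Grid m s)) * real (card (Grid m q)) * exp (- (\<Lambda> * L / r) * (\<epsilon> * r)
            + d / real q * (K * (r\<^sup>2 / L)) * ((\<Lambda> * L / r)\<^sup>2 / 2 * exp (\<Lambda> * L / r * (r / real s)) * \<sigma>\<^sup>2))
            \<le> real (s ^ CARD('d)) * real (q ^ CARD('d)) * exp (- (4 * d * L) + d * L)"
          unfolding e2 by (intro mult_mono of_nat_mono card_Grid iffD2[OF exp_le_cancel_iff] add_left_mono e) auto
        also have "\<dots> \<le> (K * exp (d * L)) * real (q ^ CARD('d)) * exp (- (4 * d * L) + d * L)"
          using pow_card_le[of s] elim by (intro mult_right_mono) (auto simp: K_def L_def)
        also have "\<dots> = (K * real q ^ CARD('d)) * (exp (d * L) * exp (- (4 * d * L) + d * L))" by simp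
        also have "exp (d * L) * exp (- (4 * d * L) + d * L) = exp (- (2 * d) * L)"
          unfolding exp_add[symmetric] by simp
        finally show "real (card (Grid m s)) * real (card (Grid m q)) *
          exp (- (\<Lambda> * LL s / sqrt (2 ^ s * LL s)) * (\<epsilon> * sqrt (2 ^ s * LL s))
            + d / real q * (2 ^ CARD('d) * 2 ^ s) *
              ((\<Lambda> * LL s / sqrt (2 ^ s * LL s))\<^sup>2 / 2 * exp (\<Lambda> * LL s / sqrt (2 ^ s * LL s) * trunc s) * \<sigma>\<^sup>2))
          \<le> (K * real q ^ CARD('d)) * exp (- (2 * d) * LL s)"
          unfolding r_def[symmetric] unfolding L_def[symmetric] K_def[symmetric] a r2 .
      qed
    qed
  qed auto
qed

text \<open>Second chaining step: an increment covers a fraction of order \<open>1 / s\<close> of the block, and the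
  exponent is then linear in \<open>s\<close>, enough for all \<open>2 ^ s\<close> points of the block.\<close>
lemma AE_fine_increments:
  assumes \<epsilon>: "0 < \<epsilon>"
  shows "AE \<omega> in M. eventually (\<lambda>s. \<forall>m. (\<Sum>i\<in>UNIV. m i) = s \<longrightarrow>
      (\<forall>n\<in>block m. \<forall>p\<in>Grid m s. real (card (Box n - Box p)) \<le> d / real s * (2 ^ CARD('d) * 2 ^ s) \<longrightarrow>
        (\<Sum>k\<in>Box n - Box p. min (X k \<omega>) (trunc s)) < \<epsilon> * sqrt (2 ^ s * LL s))) sequentially"
proof -
  define K where "K = (2::real) ^ CARD('d)"
  have K: "0 < K" by (simp add: K_def)
  \<comment> \<open>With \<open>l = \<Lambda> * s / r\<close> the linear term is
    \<open>- 2 * s\<close>, and \<open>l * trunc s\<close> is just \<open>\<Lambda>\<close>. The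
    variance term \<open>s * B / L\<close> is eventually at most \<open>s / 2\<close> and the block
    costs at most \<open>exp s\<close>, leaving \<open>exp (- s / 2)\<close> against the
    \<open>s ^ d\<close> grid points.\<close>
  define \<Lambda> where "\<Lambda> = 2 / \<epsilon>"
  have \<Lambda>: "0 < \<Lambda>" using \<epsilon> by (simp add: \<Lambda>_def)
  define B where "B = d * K * \<Lambda>\<^sup>2 / 2 * exp \<Lambda> * \<sigma>\<^sup>2"
  have "(\<lambda>s. 3 * d * (LL s / real s)) \<longlonglongrightarrow> 3 * d * 0" by (intro tendsto_mult tendsto_const LL_over_s)
  then have ev1: "eventually (\<lambda>s. 3 * d * (LL s / real s) < 1 / 2) sequentially"
    by (intro order_tendstoD(2)) auto
  have ev2: "eventually (\<lambda>s. 2 * B \<le> LL s) sequentially"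
    using LL_at_top by (simp add: filterlim_at_top)
  show ?thesis
  proof (rule AE_increments[where P = "\<lambda>s m. block m" and Q = "\<lambda>s m. Grid m s"])
    show "eventually (\<lambda>s. \<forall>m :: 'd \<Rightarrow> nat. (\<Sum>i\<in>UNIV. m i) = s \<longrightarrow> 0 \<le> \<Lambda> * real s / sqrt (2 ^ s * LL s) \<and>
      real (card (block m)) * real (card (Grid m s)) *
      exp (- (\<Lambda> * real s / sqrt (2 ^ s * LL s)) * (\<epsilon> * sqrt (2 ^ s * LL s))
        + d / real s * (2 ^ CARD('d) * 2 ^ s) *
          ((\<Lambda> * real s / sqrt (2 ^ s * LL s))\<^sup>2 / 2 * exp (\<Lambda> * real s / sqrt (2 ^ s * LL s) * trunc s) * \<sigma>\<^sup>2))
      \<le> K * exp (- (2 * d) * LL s)) sequentially"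
      using ev1 ev2 eventually_ge_at_top[of 8]
    proof eventually_elim
      case (elim s)
      define L r where "L = LL s" and "r = sqrt (2 ^ s * LL s)"
      have L: "1 \<le> L" using LL_ge_1 by (simp add: L_def)
      have r2: "2 ^ s = r\<^sup>2 / L" using L by (simp add: r_def L_def)
      have r: "0 < r" using L by (simp add: r_def L_def[symmetric])
      have a: "trunc s = r / real s" by (simp add: trunc_def r_def)
      have s: "0 < real s" using elim by simp
      show ?case
      proof (intro allI impI conjI)
        show "0 \<le> \<Lambda> * real s / sqrt (2 ^ s * LL s)" using \<Lambda> L by (simp add: L_def)
        fix m :: "'d \<Rightarrow> nat" assume m: "(\<Sum>i\<in>UNIV. m i) = s"
        have "d / real s * (K * (r\<^sup>2 / L)) * ((\<Lambda> * real s / r)\<^sup>2 / 2 * exp (\<Lambda> * real s / r * (r / real s)) * \<sigma>\<^sup>2)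
            = real s * (B / L)"
          using r L s unfolding B_def by (simp add: field_simps power2_eq_square)
        also have "\<dots> \<le> real s * (1 / 2)"
          using elim L by (intro mult_left_mono) (auto simp: L_def field_simps)
        finally have e: "d / real s * (K * (r\<^sup>2 / L)) * ((\<Lambda> * real s / r)\<^sup>2 / 2 * exp (\<Lambda> * real s / r * (r / real s)) * \<sigma>\<^sup>2) \<le> real s / 2"
          by simp
        have e2: "- (\<Lambda> * real s / r) * (\<epsilon> * r) = - (2 * real s)" using r \<epsilon> by (simp add: \<Lambda>_def)
        have e3: "(2::real) ^ s \<le> exp (real s)"
        proof -
          have "(2::real) ^ s \<le> exp 1 ^ s" using exp_ge_add_one_self[of 1] by (intro power_mono) auto
          then show ?thesis by (simp add: exp_of_nat_mult[symmetric])
        qed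
        have "real (card (block m)) * real (card (Grid m s)) * exp (- (\<Lambda> * real s / r) * (\<epsilon> * r)
            + d / real s * (K * (r\<^sup>2 / L)) * ((\<Lambda> * real s / r)\<^sup>2 / 2 * exp (\<Lambda> * real s / r * (r / real s)) * \<sigma>\<^sup>2))
            \<le> exp (real s) * real (s ^ CARD('d)) * exp (- (2 * real s) + real s / 2)"
          unfolding e2 using e3
          by (intro mult_mono of_nat_mono card_Grid iffD2[OF exp_le_cancel_iff] add_left_mono e) (simp_all add: card_block m)
        also have "\<dots> \<le> exp (real s) * (K * exp (d * L)) * exp (- (2 * real s) + real s / 2)"
          using pow_card_le[of s] elim by (intro mult_right_mono mult_left_mono) (auto simp: K_def L_def)
        also have "\<dots> = K * (exp (real s) * exp (d * L) * exp (- (2 * real s) + real s / 2))" by simp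
        also have "exp (real s) * exp (d * L) * exp (- (2 * real s) + real s / 2) = exp (d * L - real s / 2)"
          unfolding exp_add[symmetric] by simp
        also have "K * exp (d * L - real s / 2) \<le> K * exp (- (2 * d) * L)"
        proof -
          have "3 * d * (L / real s) * real s \<le> 1 / 2 * real s"
            using elim s by (intro mult_right_mono) (auto simp: L_def)
          then have "3 * d * L \<le> real s / 2" using s by simp
          then have "exp (d * L - real s / 2) \<le> exp (- (2 * d) * L)" by (simp add: algebra_simps)
          then show ?thesis using K by (intro mult_left_mono) auto
        qed
        finally show "real (card (block m)) * real (card (Grid m s)) *
          exp (- (\<Lambda> * real s / sqrt (2 ^ s * LL s)) * (\<epsilon> * sqrt (2 ^ s * LL s))
            + d / real s * (2 ^ CARD('d) * 2 ^ s) *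
              ((\<Lambda> * real s / sqrt (2 ^ s * LL s))\<^sup>2 / 2 * exp (\<Lambda> * real s / sqrt (2 ^ s * LL s) * trunc s) * \<sigma>\<^sup>2))
          \<le> K * exp (- (2 * d) * LL s)"
          unfolding r_def[symmetric] unfolding L_def[symmetric] K_def[symmetric] a r2 .
      qed
    qed
  qed auto
qed

text \<open>The only place where the sharp constant is at stake. For fixed \<open>q\<close> the
  number of grid points is bounded, so the union bound costs no part of the exponent.\<close>

lemma AE_grid_sums:
  assumes \<epsilon>: "0 < \<epsilon>"
  shows "AE \<omega> in M. eventually (\<lambda>s. \<forall>m. (\<Sum>i\<in>UNIV. m i) = s \<longrightarrow>
      (\<forall>p\<in>Grid m q. (\<Sum>k\<in>Box p. min (X k \<omega>) (trunc s)) < (\<sigma> + \<epsilon>) * sqrt (2 * d * real (idx_size p) * LL s))) sequentially"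
proof -
  define \<tau> where "\<tau> = \<sigma> + \<epsilon>"
  \<comment> \<open>The exponent will be
    \<open>- 2 * d * L + d * L * \<rho> * exp (l * trunc s)\<close>. As \<open>\<rho> < 1\<close>
    and the last factor tends to one, it falls below \<open>- d * L\<close> by a fixed proportion,
    recorded in \<open>\<theta>\<close>.\<close>
  define \<rho> where "\<rho> = (\<sigma> / \<tau>)\<^sup>2"
  have \<tau>: "0 < \<tau>" using \<epsilon> sigma2 by (simp add: \<tau>_def)
  have "\<sigma> / \<tau> < 1" "0 \<le> \<sigma> / \<tau>" using \<epsilon> sigma2 \<tau> by (simp_all add: \<tau>_def)
  then have \<rho>: "\<rho> < 1" unfolding \<rho>_def by (simp add: power_less_one_iff)
  define A where "A m = (\<Union>p\<in>Grid m q. {\<omega> \<in> space M. \<tau> * sqrt (2 * d * real (idx_size p) * LL (\<Sum>i\<in>UNIV. m i))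
      \<le> (\<Sum>k\<in>Box p. min (X k \<omega>) (trunc (\<Sum>i\<in>UNIV. m i)))})" for m
  have E: "{\<omega> \<in> space M. x \<le> (\<Sum>k\<in>Box p. min (X k \<omega>) y)} \<in> events" for x y p
    by (intro borel_measurable_le borel_measurable_const sum_min_measurable Box_subset_pos_idx)
  have A: "A m \<in> events" for m unfolding A_def by (intro sets.finite_UN finite_Grid E)
  have "(\<lambda>s. exp (sqrt (2 * d) / \<tau> * (LL s / real s)) * \<rho>) \<longlonglongrightarrow> exp (sqrt (2 * d) / \<tau> * 0) * \<rho>"
    by (intro tendsto_mult tendsto_const LL_over_s tendsto_exp)
  then have ev1: "eventually (\<lambda>s. exp (sqrt (2 * d) / \<tau> * (LL s / real s)) * \<rho> < (1 + \<rho>) / 2) sequentially"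
    using \<rho> by (intro order_tendstoD(2)) auto
  define \<theta> where "\<theta> = d * (2 - (1 + \<rho>) / 2)"
  have \<theta>: "d < \<theta>" using \<rho> d_ge_2 by (simp add: \<theta>_def)
  have "eventually (\<lambda>s. \<forall>m. (\<Sum>i\<in>UNIV. m i) = s \<longrightarrow> prob (A m) \<le> real (q ^ CARD('d)) * exp (- \<theta> * LL s)) sequentially"
    using ev1 eventually_gt_at_top[of 0]
  proof eventually_elim
    case (elim s)
    show ?case
    proof (intro allI impI)
      fix m :: "'d \<Rightarrow> nat" assume m: "(\<Sum>i\<in>UNIV. m i) = s"
      define L where "L = LL s"
      have L: "1 \<le> L" using LL_ge_1 by (simp add: L_def)
      have "prob (A m) \<le> real (card (Grid m q)) * exp (- \<theta> * L)"
        unfolding A_def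
      proof (rule prob_UN_le)
        fix p assume p: "p \<in> Grid m q"
        define N where "N = real (idx_size p)"
        have "2 ^ s \<le> idx_size p"
          using idx_size_block_ge[of p m] p Grid_subset_block m by blast
        from of_nat_mono[OF this, where 'a = real] have N: "2 ^ s \<le> N" by (simp add: N_def)
        then have N0: "0 < N" by (rule less_le_trans[rotated]) simp
        define r where "r = sqrt (2 * d * N * L)"
        have r2: "r\<^sup>2 = 2 * d * N * L" using d_ge_2 N0 L by (simp add: r_def)
        have r0: "0 \<le> r" using d_ge_2 N0 L by (simp add: r_def)
        \<comment> \<open>The optimal Gaussian parameter for threshold \<open>\<tau> * r\<close> and
          variance \<open>\<tau>\<^sup>2\<close>; unlike \<open>\<sigma>\<close>, the number
          \<open>\<tau>\<close> cannot vanish.\<close>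
        define l where "l = r / (N * \<tau>)"
        have l0: "0 \<le> l" using r0 N0 \<tau> by (simp add: l_def)
        \<comment> \<open>Because \<open>N \<ge> 2 ^ s\<close>, this is at most a constant times
          \<open>L / s\<close>, which tends to zero.\<close>
        have "l * trunc s = (r / N * sqrt (2 ^ s * L)) / (\<tau> * real s)"
          by (simp add: l_def trunc_def L_def)
        also have "r / N * sqrt (2 ^ s * L) = sqrt (2 * d * N * L / N\<^sup>2 * (2 ^ s * L))"
          using N0 unfolding r_def by (simp add: real_sqrt_mult real_sqrt_divide)
        also have "2 * d * N * L / N\<^sup>2 * (2 ^ s * L) = 2 * d * L\<^sup>2 * (2 ^ s / N)"
          using N0 by (simp add: power2_eq_square field_simps)
        also have "sqrt (2 * d * L\<^sup>2 * (2 ^ s / N)) / (\<tau> * real s) \<le> sqrt (2 * d * L\<^sup>2 * 1) / (\<tau> * real s)"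
          using N N0 \<tau> d_ge_2 L by (intro divide_right_mono real_sqrt_le_mono mult_left_mono) auto
        also have "\<dots> = sqrt (2 * d) / \<tau> * (LL s / real s)" using L by (simp add: real_sqrt_mult L_def)
        finally have la: "exp (l * trunc s) * \<rho> < (1 + \<rho>) / 2"
          using elim(1) by (smt (verit, best) \<rho>_def exp_le_cancel_iff mult_right_mono zero_le_power2)
        have "prob {\<omega> \<in> space M. \<tau> * r \<le> (\<Sum>k\<in>Box p. min (X k \<omega>) (trunc s))}
            \<le> exp (- l * (\<tau> * r) + N * (l\<^sup>2 / 2 * exp (l * trunc s) * \<sigma>\<^sup>2))"
          using trunc_pos[of s] elim l0
          by (intro prob_sum_min_ge) (auto simp: Box_subset_pos_idx card_Box N_def)
        also have "- l * (\<tau> * r) = - (r\<^sup>2 / N)"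
          using \<tau> N0 by (simp add: l_def power2_eq_square)
        also have "\<dots> = - (2 * d * L)" using N0 by (simp add: r2)
        also have "N * (l\<^sup>2 / 2 * exp (l * trunc s) * \<sigma>\<^sup>2) = r\<^sup>2 / N * (exp (l * trunc s) * \<rho>) / 2"
          using \<tau> N0 by (simp add: l_def \<rho>_def field_simps power2_eq_square)
        also have "r\<^sup>2 / N = 2 * d * L" using N0 by (simp add: r2)
        also have "exp (- (2 * d * L) + 2 * d * L * (exp (l * trunc s) * \<rho>) / 2) \<le> exp (- \<theta> * L)"
        proof -
          have "d * L * (exp (l * trunc s) * \<rho>) \<le> d * L * ((1 + \<rho>) / 2)"
            using la d_ge_2 L by (intro mult_left_mono) auto
          then show ?thesis by (simp add: \<theta>_def algebra_simps)
        qed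
        finally show "prob {\<omega> \<in> space M. \<tau> * sqrt (2 * d * real (idx_size p) * LL (\<Sum>i\<in>UNIV. m i))
            \<le> (\<Sum>k\<in>Box p. min (X k \<omega>) (trunc (\<Sum>i\<in>UNIV. m i)))} \<le> exp (- \<theta> * L)"
          unfolding m L_def[symmetric] N_def[symmetric] r_def[symmetric] .
      qed (use E in auto)
      also have "\<dots> \<le> real (q ^ CARD('d)) * exp (- \<theta> * L)"
        by (intro mult_right_mono of_nat_mono card_Grid) auto
      finally show "prob (A m) \<le> real (q ^ CARD('d)) * exp (- \<theta> * LL s)" by (simp only: L_def)
    qed
  qed
  then have "AE \<omega> in M. eventually (\<lambda>s. \<forall>m. (\<Sum>i\<in>UNIV. m i) = s \<longrightarrow> \<omega> \<notin> A m) sequentially"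
    using \<theta> by (intro AE_eventually_level_exp[OF A]) (auto simp: d_def)
  then show ?thesis
  proof (rule AE_mp, intro AE_I2 impI)
    fix \<omega> assume \<omega>: "\<omega> \<in> space M"
    assume "eventually (\<lambda>s. \<forall>m. (\<Sum>i\<in>UNIV. m i) = s \<longrightarrow> \<omega> \<notin> A m) sequentially"
    then show "eventually (\<lambda>s. \<forall>m :: 'd \<Rightarrow> nat. (\<Sum>i\<in>UNIV. m i) = s \<longrightarrow>
      (\<forall>p\<in>Grid m q. (\<Sum>k\<in>Box p. min (X k \<omega>) (trunc s)) < (\<sigma> + \<epsilon>) * sqrt (2 * d * real (idx_size p) * LL s))) sequentially"
      by eventually_elim (use \<omega> in \<open>auto simp: A_def \<tau>_def not_le\<close>)
  qed
qed

end

section \<open>The law of the iterated logarithm\<close>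

lemma eventually_multi_at_topI:
  fixes P :: "('d::finite \<Rightarrow> nat) \<Rightarrow> bool"
  assumes "\<And>n. (\<And>i. N \<le> n i) \<Longrightarrow> P n"
  shows "eventually P multi_at_top"
proof -
  have "eventually (\<lambda>n. N \<le> n i) (multi_at_top :: ('d \<Rightarrow> nat) filter)" for i
  proof -
    have "eventually (\<lambda>n. N \<le> n i) (filtercomap (\<lambda>n :: 'd \<Rightarrow> nat. n i) at_top)"
      by (intro eventually_filtercomapI eventually_ge_at_top)
    then show ?thesis
      unfolding multi_at_top_def by (rule filter_leD[OF INF_lower[OF UNIV_I]])
  qed
  then have "eventually (\<lambda>n. \<forall>i. N \<le> n i) (multi_at_top :: ('d \<Rightarrow> nat) filter)"
    by (rule eventually_all_finite)
  then show ?thesis by eventually_elim (use assms in auto)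
qed

lemma LL_mono: "s \<le> t \<Longrightarrow> LL s \<le> LL t"
  unfolding LL_def by (intro Log_mono power_increasing) auto

definition lil_norm :: "('d::finite \<Rightarrow> nat) \<Rightarrow> real" where
  "lil_norm n = sqrt (2 * real CARD('d) * real (idx_size n) * Log (Log (real (idx_size n))))"

context na_lil
begin

text \<open>The five \<open>\<epsilon>\<close> come from the sum at the coarse grid point, the two
  chaining increments, the excess, and the finitely many indices in low blocks.\<close>

lemma upper_bound:
  assumes \<epsilon>: "0 < \<epsilon>"
  shows "AE \<omega> in M. eventually (\<lambda>n. partial_sum X n \<omega> \<le> (\<sigma> + 5 * \<epsilon>) * lil_norm n) multi_at_top"
proof -
  define R where "R s = sqrt (2 ^ s * LL s)" for s
  define c where "c = \<epsilon> / (8 * d)"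
  have c: "0 < c" using \<epsilon> d_ge_2 by (simp add: c_def)
  obtain q where q: "0 < q" and B1: "AE \<omega> in M. eventually (\<lambda>s. \<forall>m. (\<Sum>i\<in>UNIV. m i) = s \<longrightarrow>
      (\<forall>p\<in>Grid m s. \<forall>p'\<in>Grid m q. real (card (Box p - Box p')) \<le> d / real q * (2 ^ CARD('d) * 2 ^ s) \<longrightarrow>
        (\<Sum>k\<in>Box p - Box p'. min (X k \<omega>) (trunc s)) < \<epsilon> * R s)) sequentially"
    using AE_coarse_increments[OF \<epsilon>] unfolding R_def by blast
  note B0 = AE_grid_sums[OF \<epsilon>, of q] and B2 = AE_fine_increments[OF \<epsilon>, folded R_def]
    and B3 = AE_medium[OF \<epsilon> c_def, folded R_def] and B4 = AE_large[OF c, folded R_def]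
  show ?thesis
    using B0 B1 B2 B3 B4
  proof eventually_elim
    case (elim \<omega>)
    define Y W where "Y s k = min (X k \<omega>) (trunc s)" and "W s k = excess (trunc s) (c * R s) (X k \<omega>)" for s k
    define good where "good s m \<longleftrightarrow>
        (\<forall>p\<in>Grid m q. (\<Sum>k\<in>Box p. Y s k) < (\<sigma> + \<epsilon>) * sqrt (2 * d * real (idx_size p) * LL s)) \<and>
        (\<forall>p\<in>Grid m s. \<forall>p'\<in>Grid m q. real (card (Box p - Box p')) \<le> d / real q * (2 ^ CARD('d) * 2 ^ s) \<longrightarrow>
          (\<Sum>k\<in>Box p - Box p'. Y s k) < \<epsilon> * R s) \<and>
        (\<forall>n\<in>block m. \<forall>p\<in>Grid m s. real (card (Box n - Box p)) \<le> d / real s * (2 ^ CARD('d) * 2 ^ s) \<longrightarrow>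
          (\<Sum>k\<in>Box n - Box p. Y s k) < \<epsilon> * R s) \<and>
        (\<Sum>k\<in>Box (\<lambda>i. 2 ^ (m i + 1)). W s k) < \<epsilon> * R s \<and>
        (\<forall>k\<in>block m. X k \<omega> \<le> c * R s)" for s m
    have "eventually (\<lambda>s. \<forall>m. (\<Sum>i\<in>UNIV. m i) = s \<longrightarrow> good s m) sequentially"
      using elim
    proof eventually_elim
      case (elim s)
      show ?case
        unfolding good_def Y_def W_def by (intro allI impI conjI elim[THEN spec, THEN mp])
    qed
    then obtain s0 where s0: "\<And>s m. s0 \<le> s \<Longrightarrow> (\<Sum>i\<in>UNIV. m i) = s \<Longrightarrow> good s m"
      unfolding eventually_sequentially by blast
    \<comment> \<open>The indices in blocks of level below \<open>s0\<close>, where the almost sure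
      bounds may still fail. A level is finite, so their total \<open>Z\<close> is a fixed number,
      absorbed as the normalisation grows.\<close>
    define K where "K = (\<Union>m\<in>(\<Union>s<s0. {m :: 'd \<Rightarrow> nat. (\<Sum>i\<in>UNIV. m i) = s}). block m)"
    have finK: "finite K" unfolding K_def by (intro finite_UN_I card_level_le(2) finite_block) auto
    define Z where "Z = (\<Sum>k\<in>K. \<bar>X k \<omega>\<bar>)"
    have "filterlim (\<lambda>s. \<epsilon> * 2 powr (real s / 4)) at_top sequentially" using \<epsilon> by real_asymp
    then have "eventually (\<lambda>s. Z \<le> \<epsilon> * 2 powr (real s / 4)) sequentially"
      by (simp add: filterlim_at_top)
    moreover have "eventually (\<lambda>s. 2 powr (real s / 4) \<le> R s) sequentially"
      using eventually_sqrt_ge[of 1] by (simp add: R_def)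
    ultimately have "eventually (\<lambda>s. Z \<le> \<epsilon> * R s) sequentially"
    proof eventually_elim
      case (elim s)
      then have "\<epsilon> * 2 powr (real s / 4) \<le> \<epsilon> * R s" using \<epsilon> by (intro mult_left_mono) auto
      then show ?case using elim by simp
    qed
    then obtain s1 where s1: "\<And>s. s1 \<le> s \<Longrightarrow> Z \<le> \<epsilon> * R s" unfolding eventually_sequentially by blast
    \<comment> \<open>The successor ensures \<open>0 < s\<close>, since \<open>s\<close> also serves
      as the number of grid points per coordinate.\<close>
    define s2 where "s2 = Suc (max s0 s1)"
    show ?case
    proof (rule eventually_multi_at_topI[of "2 ^ s2"])
      fix n :: "'d \<Rightarrow> nat" assume n: "\<And>i. 2 ^ s2 \<le> n i"
      have "n \<in> pos_idx" unfolding pos_idx_def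
        using n order_trans[OF one_le_power[of "2::nat" s2]] by simp
      then obtain m where m: "n \<in> block m" by (rule ex_block)
      define s where "s = (\<Sum>i\<in>UNIV. m i)"
      obtain j :: 'd where True by simp
      have "(2::nat) ^ s2 < 2 ^ (m j + 1)" using n[of j] m le_less_trans by (auto simp: block_def)
      then have "s2 < m j + 1" by (rule power_less_imp_less_exp[rotated]) simp
      moreover have "m j \<le> s" unfolding s_def by (rule member_le_sum) auto
      ultimately have s: "s0 \<le> s" "s1 \<le> s" "0 < s" by (auto simp: s2_def)
      define N where "N = real (idx_size n)"
      have "2 ^ s \<le> idx_size n" using idx_size_block_ge[OF m] by (simp add: s_def)
      from of_nat_mono[OF this, where 'a = real] have N: "2 ^ s \<le> N" by (simp add: N_def)
      then have LLN: "LL s \<le> Log (Log N)" unfolding LL_def by (intro Log_mono)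
      have LLN0: "0 < LL s" "0 < Log (Log N)" using LL_ge_1[of s] Log_ge_1[of "Log N"] by simp_all
      have norm_n: "lil_norm n = sqrt (2 * d * N * Log (Log N))" by (simp add: lil_norm_def N_def d_def)
      note good = s0[OF s(1) s_def[symmetric], unfolded good_def]
      define L where "L = LL s"
      have L: "1 \<le> L" using LL_ge_1 by (simp add: L_def)
      have a: "0 < trunc s" using s by (intro trunc_pos)
      have R0: "0 \<le> R s" using L by (simp add: R_def L_def)
      have W0: "0 \<le> W s k" for k using c R0 by (simp add: W_def excess_def)
      \<comment> \<open>The chain descends from \<open>n\<close> to \<open>p\<close> in the fine
        grid and from \<open>p\<close>, not from \<open>n\<close>, to \<open>p'\<close> in the
        coarse grid, so both increments are differences of nested rectangles.\<close>
      obtain p where p: "p \<in> Grid m s" "\<And>i. p i \<le> n i"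
        "real (card (Box n - Box p)) \<le> d / real s * (2 ^ CARD('d) * 2 ^ s)"
        using Grid_approx[OF m s(3)] unfolding s_def d_def by blast
      have pm: "p \<in> block m" using p Grid_subset_block by blast
      obtain p' where p': "p' \<in> Grid m q" "\<And>i. p' i \<le> p i"
        "real (card (Box p - Box p')) \<le> d / real q * (2 ^ CARD('d) * 2 ^ s)"
        using Grid_approx[OF pm q] unfolding s_def d_def by blast
      have split: "(\<Sum>k\<in>Box u. f k) = (\<Sum>k\<in>Box v. f k) + (\<Sum>k\<in>Box u - Box v. f k)"
        if "\<And>i. v i \<le> u i" for u v and f :: "('d \<Rightarrow> nat) \<Rightarrow> real"
        using sum.subset_diff[OF Box_mono[OF that], where g = f] by (simp add: add.commute)
      have "X k \<omega> \<le> Y s k + W s k + (if k \<in> K then \<bar>X k \<omega>\<bar> else 0)" if k: "k \<in> Box n" for k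
      proof (cases "k \<in> K")
        case True
        then show ?thesis using W0[of k] a by (auto simp: Y_def W_def excess_def)
      next
        case False
        \<comment> \<open>The bound on large values is known at the level of the block of
          \<open>k\<close>; as \<open>k\<close> lies below \<open>n\<close>, that level is at most
          \<open>s\<close> and the bound carries over to \<open>R s\<close>.\<close>
        obtain l where l: "k \<in> block l" using k Box_subset_pos_idx ex_block by blast
        have "l i \<le> m i" for i using k by (intro block_mono[OF l m]) (auto simp: Box_def)
        then have ls: "(\<Sum>i\<in>UNIV. l i) \<le> s" unfolding s_def by (intro sum_mono) auto
        have "s0 \<le> (\<Sum>i\<in>UNIV. l i)" using False l by (force simp: K_def not_less)
        then have "X k \<omega> \<le> c * R (\<Sum>i\<in>UNIV. l i)" using s0[OF _ refl, of l] l by (simp add: good_def)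
        also have "\<dots> \<le> c * R s"
          unfolding R_def using c ls LL_mono[OF ls] LL_ge_1[of "\<Sum>i\<in>UNIV. l i"]
          by (intro mult_left_mono real_sqrt_le_mono mult_mono power_increasing) auto
        finally show ?thesis using a c R0 by (auto simp: Y_def W_def excess_def)
      qed
      then have "partial_sum X n \<omega> \<le> (\<Sum>k\<in>Box n. Y s k + W s k + (if k \<in> K then \<bar>X k \<omega>\<bar> else 0))"
        unfolding partial_sum_def Box_def[symmetric] by (rule sum_mono)
      also have "\<dots> = (\<Sum>k\<in>Box n. Y s k) + (\<Sum>k\<in>Box n. W s k) + (\<Sum>k\<in>Box n \<inter> K. \<bar>X k \<omega>\<bar>)"
        by (simp add: sum.distrib sum.inter_restrict)
      also have "(\<Sum>k\<in>Box n \<inter> K. \<bar>X k \<omega>\<bar>) \<le> Z" unfolding Z_def using finK by (intro sum_mono2) auto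
      also have "Z \<le> \<epsilon> * R s" by (rule s1[OF s(2)])
      also have "(\<Sum>k\<in>Box n. W s k) \<le> (\<Sum>k\<in>Box (\<lambda>i. 2 ^ (m i + 1)). W s k)"
        using m W0 by (intro sum_mono2 Box_mono) (auto simp: block_def less_imp_le)
      also have "\<dots> \<le> \<epsilon> * R s" using good by simp
      also have "(\<Sum>k\<in>Box n. Y s k)
          = (\<Sum>k\<in>Box p'. Y s k) + (\<Sum>k\<in>Box p - Box p'. Y s k) + (\<Sum>k\<in>Box n - Box p. Y s k)"
        using split[OF p(2)] split[OF p'(2)] by simp
      also have "(\<Sum>k\<in>Box n - Box p. Y s k) \<le> \<epsilon> * R s" using good m p by (simp add: less_imp_le)
      also have "(\<Sum>k\<in>Box p - Box p'. Y s k) \<le> \<epsilon> * R s" using good p p' by (simp add: less_imp_le)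
      also have "(\<Sum>k\<in>Box p'. Y s k) \<le> (\<sigma> + \<epsilon>) * sqrt (2 * d * real (idx_size p') * L)"
        using good p' by (simp add: less_imp_le L_def)
      also have "\<dots> \<le> (\<sigma> + \<epsilon>) * lil_norm n"
      proof (intro mult_left_mono)
        show "sqrt (2 * d * real (idx_size p') * L) \<le> lil_norm n"
          unfolding norm_n L_def N_def
          using LLN LLN0 d_ge_2 idx_size_mono[of p' n] order_trans[OF p'(2) p(2)]
          by (intro real_sqrt_le_mono mult_mono mult_left_mono) (auto simp: N_def)
      qed (use \<epsilon> sigma2 in auto)
      finally have "partial_sum X n \<omega> \<le> (\<sigma> + \<epsilon>) * lil_norm n + \<epsilon> * R s + \<epsilon> * R s + \<epsilon> * R s + \<epsilon> * R s"
        by simp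
      moreover have "\<epsilon> * R s \<le> \<epsilon> * lil_norm n"
      proof (intro mult_left_mono)
        have "2 ^ s * LL s \<le> N * Log (Log N)"
          using N LLN LLN0 by (intro mult_mono) (auto intro: order_trans[OF _ N])
        also have "\<dots> \<le> 2 * d * (N * Log (Log N))"
        proof -
          have "0 \<le> N * Log (Log N)" using LLN0 by (simp add: N_def)
          then have "1 * (N * Log (Log N)) \<le> 2 * d * (N * Log (Log N))"
            using d_ge_2 by (intro mult_right_mono) auto
          then show ?thesis by simp
        qed
        finally show "R s \<le> lil_norm n" unfolding R_def norm_n by (simp add: mult_ac)
      qed (use \<epsilon> in simp)
      ultimately show "partial_sum X n \<omega> \<le> (\<sigma> + 5 * \<epsilon>) * lil_norm n" by (simp add: algebra_simps)
    qed
  qed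
qed

end

section \<open>Passage to the negated field and the two-sided limit superior\<close>

lemma na_family_uminus:
  fixes I :: "'i set"
  assumes "na_family M I X i0"
  shows "na_family M I (\<lambda>i \<omega>. - X i \<omega>) i0"
proof -
  interpret na_family M I X i0 by fact
  show ?thesis
  proof unfold_locales
    show "distr M borel (\<lambda>\<omega>. - X i \<omega>) = distr M borel (\<lambda>\<omega>. - X i0 \<omega>)" if "i \<in> I" for i
    proof -
      have "distr M borel (\<lambda>\<omega>. - X j \<omega>) = distr (distr M borel (X j)) borel uminus" if "j \<in> I" for j
        using distr_distr[OF borel_measurable_uminus[OF measurable_ident_sets[OF refl]] X_meas[OF that]]
        by (simp add: comp_def)
      then show ?thesis by (simp only: that i0 X_ident[OF that])
    qed
    show "neg_assoc M I (\<lambda>i \<omega>. - X i \<omega>)"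
      unfolding neg_assoc_def
    proof (intro allI impI)
      fix A B :: "'i set" and f g :: "('i \<Rightarrow> real) \<Rightarrow> real"
      \<comment> \<open>The reflection \<open>- f (- x)\<close> is again coordinatewise
        nondecreasing, and the two outer signs cancel in the covariance.\<close>
      define f' g' where "f' x = - f (restrict (\<lambda>i. - x i) A)" and "g' x = - g (restrict (\<lambda>i. - x i) B)" for x
      have f': "f' (restrict (\<lambda>i. X i \<omega>) A) = - f (restrict (\<lambda>i. - X i \<omega>) A)" for \<omega>
        unfolding f'_def by (auto intro!: arg_cong[of _ _ f] restrict_ext)
      have g': "g' (restrict (\<lambda>i. X i \<omega>) B) = - g (restrict (\<lambda>i. - X i \<omega>) B)" for \<omega>
        unfolding g'_def by (auto intro!: arg_cong[of _ _ g] restrict_ext)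
      assume *: "finite A \<and> finite B \<and> A \<subseteq> I \<and> B \<subseteq> I \<and> A \<inter> B = {} \<and> coord_mono A f \<and> coord_mono B g \<and>
        integrable M (\<lambda>\<omega>. f (restrict (\<lambda>i. - X i \<omega>) A)) \<and>
        integrable M (\<lambda>\<omega>. g (restrict (\<lambda>i. - X i \<omega>) B)) \<and>
        integrable M (\<lambda>\<omega>. f (restrict (\<lambda>i. - X i \<omega>) A) * g (restrict (\<lambda>i. - X i \<omega>) B))"
      have "coord_mono A f'" "coord_mono B g'"
        using * unfolding coord_mono_def f'_def g'_def by auto
      then show "expectation (\<lambda>\<omega>. f (restrict (\<lambda>i. - X i \<omega>) A) * g (restrict (\<lambda>i. - X i \<omega>) B))
        - expectation (\<lambda>\<omega>. f (restrict (\<lambda>i. - X i \<omega>) A)) * expectation (\<lambda>\<omega>. g (restrict (\<lambda>i. - X i \<omega>) B)) \<le> 0"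
        using X_na[unfolded neg_assoc_def, rule_format, of A B f' g'] * unfolding f' g' by simp
    qed
  qed (use i0 X_meas in auto)
qed

theorem theorem1p2:
  fixes M :: "'a measure" and X :: "('d::finite \<Rightarrow> nat) \<Rightarrow> 'a \<Rightarrow> real"
  assumes "prob_space M"
    and "CARD('d) \<ge> 2"
    and "\<And>n. n \<in> pos_idx \<Longrightarrow> X n \<in> borel_measurable M"
    and "neg_assoc M pos_idx X"
    and "\<And>n. n \<in> pos_idx \<Longrightarrow> distr M borel (X n) = distr M borel (X (\<lambda>_. 1))"
    and "integrable M (X (\<lambda>_. 1))"
    and "(\<integral>\<omega>. X (\<lambda>_. 1) \<omega> \<partial>M) = 0"
    and "integrable M (\<lambda>\<omega>. (X (\<lambda>_. 1) \<omega>)\<^sup>2 * (Log \<bar>X (\<lambda>_. 1) \<omega>\<bar>) ^ (CARD('d) - 1)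
                             / Log (Log \<bar>X (\<lambda>_. 1) \<omega>\<bar>))"
  shows "AE \<omega> in M.
    Limsup multi_at_top
      (\<lambda>n. ereal (\<bar>partial_sum X n \<omega>\<bar> /
         sqrt (2 * real CARD('d) * real (idx_size n) * Log (Log (real (idx_size n))))))
    \<le> ereal (sqrt (\<integral>\<omega>. (X (\<lambda>_. 1) \<omega>)\<^sup>2 \<partial>M))"
proof -
  interpret prob_space M by fact
  define i1 :: "'d \<Rightarrow> nat" where "i1 = (\<lambda>_. 1)"
  have i1: "i1 \<in> pos_idx" by (simp add: i1_def pos_idx_def)
  note asm = assms[folded i1_def]
  interpret fam: na_family M pos_idx X i1
    by unfold_locales (rule i1 asm; assumption?)+
  interpret up: na_lil M X i1
    by unfold_locales (rule asm)+
  interpret fam': na_family M pos_idx "\<lambda>n \<omega>. - X n \<omega>" i1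
    by (rule na_family_uminus) (rule fam.na_family_axioms)
  interpret lo: na_lil M "\<lambda>n \<omega>. - X n \<omega>" i1
    by unfold_locales (use asm in auto)
  define \<sigma> where "\<sigma> = sqrt (expectation (\<lambda>\<omega>. (X i1 \<omega>)\<^sup>2))"
  have \<sigma>: "up.\<sigma> = \<sigma>" "lo.\<sigma> = \<sigma>" by (simp_all add: up.\<sigma>_def lo.\<sigma>_def \<sigma>_def)
  have neg: "partial_sum (\<lambda>n \<omega>. - X n \<omega>) n \<omega> = - partial_sum X n \<omega>" for n \<omega>
    by (simp add: partial_sum_def sum_negf)
  \<comment> \<open>A countable sequence of tolerances, so that the exceptional null sets can be
    united before letting the tolerance tend to zero.\<close>
  define e where "e j = 1 / real (Suc j)" for j
  have e: "0 < e j" for j by (simp add: e_def)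
  have "AE \<omega> in M. \<forall>j. eventually (\<lambda>n. partial_sum X n \<omega> \<le> (\<sigma> + 5 * e j) * lil_norm n) multi_at_top"
    using up.upper_bound[OF e] by (simp add: AE_all_countable \<sigma>)
  moreover have "AE \<omega> in M. \<forall>j. eventually (\<lambda>n. - partial_sum X n \<omega> \<le> (\<sigma> + 5 * e j) * lil_norm n) multi_at_top"
    using lo.upper_bound[OF e] by (simp add: AE_all_countable \<sigma> neg)
  ultimately have "AE \<omega> in M. Limsup multi_at_top (\<lambda>n. ereal (\<bar>partial_sum X n \<omega>\<bar> / lil_norm n)) \<le> ereal \<sigma>"
  proof eventually_elim
    case (elim \<omega>)
    define l where "l = Limsup multi_at_top (\<lambda>n. ereal (\<bar>partial_sum X n \<omega>\<bar> / lil_norm n))"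
    have pos: "eventually (\<lambda>n :: 'd \<Rightarrow> nat. 0 < lil_norm n) multi_at_top"
    proof (rule eventually_multi_at_topI[of 1])
      fix n :: "'d \<Rightarrow> nat" assume n: "\<And>i. 1 \<le> n i"
      then have "0 < idx_size n" unfolding idx_size_def by (intro prod_pos) (auto simp: Suc_le_eq)
      then show "0 < lil_norm n"
        using Log_ge_1[of "Log (real (idx_size n))"] by (simp add: lil_norm_def)
    qed
    have "l \<le> ereal (\<sigma> + 5 * e j)" for j
      unfolding l_def
    proof (rule Limsup_bounded)
      show "eventually (\<lambda>n. ereal (\<bar>partial_sum X n \<omega>\<bar> / lil_norm n) \<le> ereal (\<sigma> + 5 * e j)) multi_at_top"
        using pos elim(1)[rule_format, of j] elim(2)[rule_format, of j]
        by eventually_elim (auto simp: field_simps abs_le_iff)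
    qed
    moreover have "(\<lambda>j. ereal (\<sigma> + 5 * e j)) \<longlonglongrightarrow> ereal (\<sigma> + 5 * 0)"
      unfolding e_def using LIMSEQ_inverse_real_of_nat
      by (intro tendsto_intros) (simp add: inverse_eq_divide)
    ultimately show "l \<le> ereal \<sigma>" by (intro LIMSEQ_le_const[where X = "\<lambda>j. ereal (\<sigma> + 5 * e j)"]) auto
  qed
  then show ?thesis unfolding lil_norm_def \<sigma>_def i1_def .
qed

end
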